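(* The Grassmannian nonstandard operators are not strongly invariant. That is, for each $2\le k\le n$ there exists no $\mathfrak p$-module homomorphism $\widetilde\Phi:\bar{\mathcal J}^4(\mathbb V_{k-2})\to\mathbb V_k$ whose restriction to $\mathcal J^4(\mathbb V_{k-2})\subset\bar{\mathcal J}^4(\mathbb V_{k-2})$ coincides with the $\mathfrak p$-homomorphism $\Phi:\mathcal J^4(\mathbb V_{k-2})\to\mathbb V_k$ that induces the nonstandard operator $\widetilde\square_{ABCD}$ on locally flat Grassmannian structures.
   Context: **Algebra.** Let $n\ge2$, $\mathfrak g=\mathfrak{sl}(n+2,\mathbb R)=\mathfrak g_{-1}\oplus\mathfrak g_0\oplus\mathfrak g_1$ be the $|1|$-grading with $\mathfrak g_0=\mathfrak s(\mathfrak{gl}(2,\mathbb R)\oplus\mathfrak{gl}(n,\mathbb R))$ and $\mathfrak g_1\cong\mathfrak g_{-1}^*\cong\mathbb R^2\otimes\mathbb R^{n*}$, and let $\mathfrak p=\mathfrak g_0\oplus\mathfrak g_1$. Let $G=SL(n+2,\mathbb R)$ and let $P$ be the stabilizer of $\mathbb R^2\subset\mathbb R^{n+2}$, with Lie algebra $\mathfrak p$. Primed indices refer to $\mathbb R^2$ (upper) and its dual, unprimed lower indices to $\mathbb R^{n*}$; so elements of $\mathfrak g_{-1}^*$ are written $\omega^{A'}_A$. $\mathbb R[-1]:=\Lambda^2\mathbb R^2\cong\Lambda^n\mathbb R^{n*}$, with $\mathbb R[w]$ its powers, and $V[w]=V\otimes\mathbb R[w]$. Primed indices are raised and lowered with the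 canonical element $\epsilon^{A'B'}\in\Lambda^2\mathbb R^2[1]$ and its inverse, via $v^{B'}=v_{A'}\epsilon^{A'B'}$, $v_{B'}=v^{A'}\epsilon_{A'B'}$. **Modules.** For $0\le k\le n$, $\mathbb V_k$ is the irreducible $\mathfrak g_0$-module (with trivial $\mathfrak g_1$-action) $\mathbb V_k=\mathcal Y_{k,k}(\mathbb R^{n*})[-k]$, where $\mathcal Y_{k,k}(F)\subset\Lambda^kF\otimes\Lambda^kF$ is the irreducible component whose Young diagram has two columns of height $k$. **Jets.** For a $\mathfrak p$-module $\mathbb V$, $\mathcal J^r(\mathbb V)$ is the $\mathfrak p$-module given by the fibre at the origin of the $r$-th jet prolongation of the homogeneous bundle $G\times_P\mathbb V\to G/P$. As a $\mathfrak g_0$-module it is $\bigoplus_{i\le r}S^i\mathfrak g_{-1}^*\otimes\mathbb V$. The semi-holonomic jet prolongation is defined inductively by $\bar{\mathcal J}^0(\mathbb V)=\mathbb V$, $\bar{\mathcal J}^1(\mathbb V)=\mathcal J^1(\mathbb V)$, and $\bar{\mathcal J}^{r}(\mathbb V)\subset\mathcal J^1(\bar{\mathcal J}^{r-1}(\mathbb V))$ the submodule on which the two natural projections to $\mathcal J^1(\bar{\mathcal J}^{r-2}(\mathbb V))$ agree. As a $\mathfrak g_0$-module, $\bar{\mathcal J}^r(\mathbb V)=\bigoplus_{i\le r}\otimes^i\mathfrak g_{-1}^*\otimes\mathbb V$, and $\mathcal J^r(\mathbb V)\subset\bar{\mathcal J}^r(\mathbb V)$ is a $\mathfrak p$-submodule.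 **The nonstandard operators.** An almost Grassmannian structure of type $(2,n)$ on a manifold $M$ of dimension $2n$ consists of bundles $\mathcal E^{A'}$ (rank 2) and $\mathcal E^A$ (rank $n$) with $TM\cong\mathcal E_{A'}\otimes\mathcal E^A$ and $\Lambda^2\mathcal E_{A'}\cong\Lambda^n\mathcal E^A$. It is locally flat if locally isomorphic to $G/P$. On locally flat structures the nonstandard operator is, for a local torsion-free flat compatible connection $\nabla$, $$\widetilde\square_{ABCD}:\mathcal Y_{k-2,k-2}(\mathcal E_A)[-k+2]\to\mathcal Y_{k,k}(\mathcal E_A)[-k],\qquad\sigma\mapsto\nabla_{I'A}\nabla^{I'}_B\nabla_{J'C}\nabla^{J'}_D\sigma,$$ followed by the natural projection to the target. It is invariant and is induced by the $\mathfrak p$-homomorphism $\Phi:\mathcal J^4(\mathbb V_{k-2})\to\mathbb V_k$ which factors through the $\mathfrak g_0$-equivariant projection $\mathcal J^4(\mathbb V_{k-2})\to S^4\mathfrak g_{-1}^*\otimes\mathbb V_{k-2}$ and is given there by $$\phi(\omega)_{ABCD\mathbf E\mathbf F}=\tfrac12\big(\omega_{I'[AB}{}^{I'}{}_{|J'|CD]'}{}^{J'}+\omega_{I'[CD}{}^{I'}{}_{|J'|AB]'}{}^{J'}\big)_{\mathbf E\mathbf F}-\omega_{I'\,J'}{}^{I'\,J'}{}_{[ABCD]\,\mathbf E\mathbf F}.$$ In this formula the four $\mathfrak g_{-1}^*$-slots have unprimed indices in the order displayed; primed indices of slots $1,2$ are contracted with each other (first index lowered), as are those of slots $3,4$. In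 the first two terms one alternates separately over $A,B$ and over $C,D$, and in the last term over all of $A,B,C,D$. The result takes values in $\mathbb V_2\otimes\mathbb V_{k-2}$ and is followed by the unique (up to scale) $\mathfrak g_0$-projection $\mathbb V_2\otimes\mathbb V_{k-2}\to\mathbb V_k$. An operator that coincides with $\widetilde\square_{ABCD}$ on locally flat structures is called strongly invariant if it is induced by a $\mathfrak p$-homomorphism $\bar{\mathcal J}^4(\mathbb V_{k-2})\to\mathbb V_k$, necessarily extending $\Phi$. *)

theory Defs
  imports "HOL-Analysis.Analysis"
begin

text \<open>
  The standing dimension \<open>n\<close> is \<open>CARD('n)\<close>. Every module is realised as a linear subspace of a space
  of coordinate functions \<open>'c \<Rightarrow> real\<close>, so that derivatives of module-valued functions are taken
  coordinatewise.
\<close>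

subsection \<open>The graded Lie algebra\<close>

text \<open>
  Matrices on \<open>\<real>\<^sup>2 \<oplus> \<real>\<^sup>n\<close>. With respect to \<open>M = (A, Z; X, B)\<close> (blocks), \<open>X\<close> spans \<open>\<gg>\<^sub>-\<^sub>1\<close>, the pairs
  \<open>(A, B)\<close> of total trace zero form \<open>\<gg>\<^sub>0\<close>, and \<open>Z\<close> spans \<open>\<gg>\<^sub>1\<close>.
\<close>

type_synonym 'n gmat = "real ^ (2 + 'n) ^ (2 + 'n)"

text \<open>\<open>\<gg>\<^sub>-\<^sub>1 = Hom(\<real>\<^sup>2, \<real>\<^sup>n)\<close>; the component \<open>x $ A $ A'\<close> is the entry in row \<open>A\<close> and column \<open>A'\<close>.\<close>

type_synonym 'n gminus = "real ^ 2 ^ 'n"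

definition gm_embed :: "'n::finite gminus \<Rightarrow> 'n gmat" where
  "gm_embed x = (\<chi> i j. case (i, j) of (Inr A, Inl A') \<Rightarrow> x $ A $ A' | _ \<Rightarrow> 0)"

definition gm_part :: "'n::finite gmat \<Rightarrow> 'n gminus" where
  "gm_part M = (\<chi> A A'. M $ Inr A $ Inl A')"

definition p_part :: "'n::finite gmat \<Rightarrow> 'n gmat" where
  "p_part M = M - gm_embed (gm_part M)"

definition p_alg :: "'n::finite gmat set" where
  "p_alg = {M. trace M = 0 \<and> (\<forall>A A'. M $ Inr A $ Inl A' = 0)}"

definition g0_alg :: "'n::finite gmat set" where
  "g0_alg = {M \<in> p_alg. \<forall>A' A. M $ Inl A' $ Inr A = 0}"

subsection \<open>Modules and homomorphisms\<close>

record ('n, 'c) gmodule =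
  vecs :: "('c \<Rightarrow> real) set"
  act :: "'n gmat \<Rightarrow> ('c \<Rightarrow> real) \<Rightarrow> 'c \<Rightarrow> real"

definition gmodule_hom ::
  "'n::finite gmat set \<Rightarrow> ('n, 'c) gmodule \<Rightarrow> ('n, 'd) gmodule \<Rightarrow> (('c \<Rightarrow> real) \<Rightarrow> 'd \<Rightarrow> real) \<Rightarrow> bool"
  where
  "gmodule_hom L V W F \<longleftrightarrow>
     (\<forall>u\<in>vecs V. F u \<in> vecs W) \<and>
     (\<forall>u\<in>vecs V. \<forall>v\<in>vecs V. \<forall>a b.
        F (\<lambda>c. a * u c + b * v c) = (\<lambda>d. a * F u d + b * F v d)) \<and>
     (\<forall>M\<in>L. \<forall>u\<in>vecs V. F (act V M u) = act W M (F u))"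

definition tensor_module ::
  "('n::finite, 'c) gmodule \<Rightarrow> ('n, 'd) gmodule \<Rightarrow> ('n, 'c \<times> 'd) gmodule" where
  "tensor_module V W =
     \<lparr> vecs = {\<lambda>(c, d). \<Sum>i<m. u i c * v i d | (m::nat) u v. \<forall>i<m. u i \<in> vecs V \<and> v i \<in> vecs W},
       act = (\<lambda>M t (c, d). act V M (\<lambda>c'. t (c', d)) c + act W M (\<lambda>d'. t (c, d')) d) \<rparr>"

subsection \<open>The modules \<open>\<V>\<^sub>k\<close>\<close>

text \<open>
  A tensor in \<open>F\<^sup>\<otimes>\<^sup>k \<otimes> F\<^sup>\<otimes>\<^sup>k\<close>, \<open>F = \<real>\<^sup>n\<^sup>*\<close>, is given by its components at \<open>(as, bs)\<close>, two lists of length \<open>k\<close>.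
  The lists are the two columns of the Young diagram, and its rows are the pairs \<open>(as ! i, bs ! i)\<close>.
\<close>

definition row_swap :: "nat \<Rightarrow> nat set \<Rightarrow> 'n list \<times> 'n list \<Rightarrow> 'n list \<times> 'n list" where
  "row_swap k S = (\<lambda>(as, bs).
     (map (\<lambda>i. if i \<in> S then bs ! i else as ! i) [0..<k],
      map (\<lambda>i. if i \<in> S then as ! i else bs ! i) [0..<k]))"

definition young_symmetrizer ::
  "nat \<Rightarrow> ('n list \<times> 'n list \<Rightarrow> real) \<Rightarrow> 'n list \<times> 'n list \<Rightarrow> real" where
  "young_symmetrizer k t = (\<lambda>(as, bs).
     if length as = k \<and> length bs = k
     then \<Sum>p | p permutes {..<k}. \<Sum>q | q permutes {..<k}. of_int (sign p * sign q) *
            (\<Sum>S\<in>Pow {..<k}. t (row_swap k S (permute_list p as, permute_list q bs)))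
     else 0)"

text \<open>
  \<open>\<V>\<^sub>k = \<Y>\<^sub>k\<^sub>,\<^sub>k(F)[-k]\<close>, where \<open>\<Y>\<^sub>k\<^sub>,\<^sub>k(F) \<subset> \<Lambda>\<^sup>k F \<otimes> \<Lambda>\<^sup>k F\<close> is the image of the Young symmetrizer (columns are
  alternated last). The weight \<open>[-k]\<close> is the factor \<open>(\<Lambda>\<^sup>2 \<real>\<^sup>2)\<^sup>k\<close>, on which \<open>(A, B) \<in> \<gg>\<^sub>0\<close> acts by \<open>k tr A\<close>;
  on \<open>F\<close> it acts by \<open>u \<mapsto> - u B\<close>. The block \<open>Z\<close> does not enter, so \<open>\<gg>\<^sub>1\<close> acts trivially.
\<close>

definition V_mod :: "nat \<Rightarrow> ('n::finite, 'n list \<times> 'n list) gmodule" where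
  "V_mod k =
     \<lparr> vecs = range (young_symmetrizer k),
       act = (\<lambda>M t (as, bs).
         real k * (\<Sum>A'\<in>UNIV. M $ Inl A' $ Inl A') * t (as, bs)
         - (\<Sum>i<k. \<Sum>C\<in>UNIV. M $ Inr C $ Inr (as ! i) * t (as[i := C], bs))
         - (\<Sum>i<k. \<Sum>C\<in>UNIV. M $ Inr C $ Inr (bs ! i) * t (as, bs[i := C]))) \<rparr>"

subsection \<open>Sections and jets\<close>

text \<open>
  Near the origin, sections of \<open>G \<times>\<^sub>P W\<close> are functions \<open>f : \<gg>\<^sub>-\<^sub>1 \<rightarrow> W\<close>, the restrictions to
  \<open>exp x = 1 + x\<close> of equivariant functions on \<open>G\<close> (\<open>f(gp) = p\<^sup>-\<^sup>1 f(g)\<close>). Since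
  \<open>exp(-tM) exp(x) = exp(x) exp(-t h)\<close> with \<open>h = Ad(exp(-x)) M = (1 - x) M (1 + x)\<close>, the action
  \<open>(M f)(g) = d/dt f(exp(-tM) g)\<close> at \<open>t = 0\<close> is the following operator.
\<close>

definition section_act ::
  "('n::finite, 'c) gmodule \<Rightarrow> 'n gmat \<Rightarrow> ('n gminus \<Rightarrow> 'c \<Rightarrow> real) \<Rightarrow> 'n gminus \<Rightarrow> 'c \<Rightarrow> real" where
  "section_act W M f x =
     (let h = (mat 1 - gm_embed x) ** M ** (mat 1 + gm_embed x)
      in (\<lambda>c. act W (p_part h) (f x) c
              - frechet_derivative (\<lambda>y. f y c) (at x) (gm_part h)))"

text \<open>
  A slot \<open>(A', A)\<close> is an index pair of \<open>\<omega>\<^sup>A\<^sup>'\<^sub>A \<in> \<gg>\<^sub>-\<^sub>1\<^sup>*\<close>, that is, the value of \<open>\<omega>\<close> on the basis vector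
  \<open>gm_basis (A', A)\<close>. In the coordinates of a 1-jet, \<open>None\<close> marks the value and \<open>Some s\<close> the
  derivative in direction \<open>s\<close>.
\<close>

type_synonym 'n slot = "2 \<times> 'n"
type_synonym ('n, 'c) jc = "'n slot option \<times> 'c"

definition gm_basis :: "'n::finite slot \<Rightarrow> 'n gminus" where
  "gm_basis = (\<lambda>(A', A). axis A (axis A' 1))"

definition partial_deriv :: "'n::finite slot \<Rightarrow> ('n gminus \<Rightarrow> real) \<Rightarrow> 'n gminus \<Rightarrow> real" where
  "partial_deriv s g x = frechet_derivative g (at x) (gm_basis s)"

text \<open>
  The section \<open>j\<^sup>1 f\<close> of \<open>G \<times>\<^sub>P J\<^sup>1(W)\<close> defined by a section \<open>f\<close>. Its value at \<open>exp x\<close> is the 1-jet at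
  the origin of \<open>f\<close> composed with left translation by \<open>exp x\<close>, which is \<open>y \<mapsto> f (x + y)\<close> because
  \<open>\<gg>\<^sub>-\<^sub>1\<close> is abelian.
\<close>

definition jet1 :: "('n::finite gminus \<Rightarrow> 'c \<Rightarrow> real) \<Rightarrow> 'n gminus \<Rightarrow> ('n, 'c) jc \<Rightarrow> real" where
  "jet1 f x = (\<lambda>(z, c). case z of None \<Rightarrow> f x c | Some s \<Rightarrow> partial_deriv s (\<lambda>y. f y c) x)"

definition affine_section :: "(('n::finite, 'c) jc \<Rightarrow> real) \<Rightarrow> 'n gminus \<Rightarrow> 'c \<Rightarrow> real" where
  "affine_section j x c = j (None, c) + (\<Sum>(A', A)\<in>UNIV. x $ A $ A' * j (Some (A', A), c))"

text \<open>
  The action is \<open>M (j\<^sup>1\<^sub>0 f) = j\<^sup>1\<^sub>0 (M f)\<close>, evaluated on the affine representative \<open>f\<close> of the jet. For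
  \<open>M \<in> \<pp>\<close> the vector field \<open>x \<mapsto> gm_part h\<close> vanishes at the origin, so any other representative
  gives the same result.
\<close>

definition J1_mod :: "('n::finite, 'c) gmodule \<Rightarrow> ('n, ('n, 'c) jc) gmodule" where
  "J1_mod W =
     \<lparr> vecs = {j. \<forall>z. (\<lambda>c. j (z, c)) \<in> vecs W},
       act = (\<lambda>M j. jet1 (section_act W M (affine_section j)) 0) \<rparr>"

definition jet_proj :: "(('n, 'c) jc \<Rightarrow> real) \<Rightarrow> 'c \<Rightarrow> real" where
  "jet_proj j = (\<lambda>c. j (None, c))"

definition jet_map ::
  "(('c \<Rightarrow> real) \<Rightarrow> 'd \<Rightarrow> real) \<Rightarrow> (('n, 'c) jc \<Rightarrow> real) \<Rightarrow> ('n, 'd) jc \<Rightarrow> real" where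
  "jet_map F j = (\<lambda>(z, d). F (\<lambda>c. j (z, c)) d)"

text \<open>
  One step of the semi-holonomic prolongation: for a submodule \<open>W\<close> of \<open>J\<^sup>1(U)\<close>, the submodule of
  \<open>J\<^sup>1(W)\<close> where the projections \<open>J\<^sup>1(W) \<rightarrow> W \<subset> J\<^sup>1(U)\<close> and \<open>J\<^sup>1(W \<rightarrow> U)\<close> agree.
\<close>

definition semihol_step ::
  "('n::finite, ('n, 'c) jc) gmodule \<Rightarrow> ('n, ('n, ('n, 'c) jc) jc) gmodule" where
  "semihol_step W =
     \<lparr> vecs = {j \<in> vecs (J1_mod W). jet_proj j = jet_map jet_proj j},
       act = act (J1_mod W) \<rparr>"

type_synonym ('n, 'c) jc4 = "('n, ('n, ('n, ('n, 'c) jc) jc) jc) jc"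

definition Jbar4_mod :: "('n::finite, 'c) gmodule \<Rightarrow> ('n, ('n, 'c) jc4) gmodule" where
  "Jbar4_mod V = semihol_step (semihol_step (semihol_step (J1_mod V)))"

definition smooth_fun :: "('n::finite gminus \<Rightarrow> real) \<Rightarrow> bool" where
  "smooth_fun g \<longleftrightarrow> (\<forall>ss x. fold partial_deriv ss g differentiable at x)"

text \<open>
  The image of \<open>J\<^sup>4(V)\<close> in the semi-holonomic jets under \<open>j\<^sup>4\<^sub>0 f \<mapsto> j\<^sup>1 j\<^sup>1 j\<^sup>1 j\<^sup>1 f (0)\<close>.
  Globally defined sections suffice, since every jet has a polynomial representative.
\<close>

definition J4_vecs :: "('n::finite, 'c) gmodule \<Rightarrow> (('n, 'c) jc4 \<Rightarrow> real) set" where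
  "J4_vecs V =
     {jet1 (jet1 (jet1 (jet1 f))) 0 | f. (\<forall>x. f x \<in> vecs V) \<and> (\<forall>c. smooth_fun (\<lambda>x. f x c))}"

subsection \<open>The homomorphism \<open>\<Phi>\<close>\<close>

definition top_proj ::
  "(('n, 'c) jc4 \<Rightarrow> real) \<Rightarrow> 'n slot \<times> 'n slot \<times> 'n slot \<times> 'n slot \<times> 'c \<Rightarrow> real" where
  "top_proj j = (\<lambda>(s1, s2, s3, s4, c). j (Some s1, Some s2, Some s3, Some s4, c))"

text \<open>
  The form \<open>\<epsilon>\<close> with lower primed indices, where \<open>\<real>[-1] = \<Lambda>\<^sup>2 \<real>\<^sup>2\<close> is trivialised so that the upper
  form has \<open>\<epsilon>(0, 1) = 1\<close>. The conventions \<open>v^B' = v_A' \<epsilon>^(A'B')\<close> and \<open>v_B' = v^A' \<epsilon>_(A'B')\<close> force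
  \<open>\<epsilon>^(C'A') \<epsilon>_(A'B') = \<delta>\<close>, hence the sign.
\<close>

definition eps_lower :: "2 \<Rightarrow> 2 \<Rightarrow> real" where
  "eps_lower a b = (if a = b then 0 else if a = 0 then -1 else 1)"

definition phi_contract ::
  "('n slot \<times> 'n slot \<times> 'n slot \<times> 'n slot \<times> 'c \<Rightarrow> real) \<Rightarrow> 'c \<Rightarrow> 'n \<Rightarrow> 'n \<Rightarrow> 'n \<Rightarrow> 'n \<Rightarrow> real" where
  "phi_contract w c A B C D =
     (\<Sum>K\<in>UNIV. \<Sum>I\<in>UNIV. \<Sum>L\<in>UNIV. \<Sum>J\<in>UNIV.
        eps_lower K I * eps_lower L J * w ((K, A), (I, B), (L, C), (J, D), c))"

definition alt_pairs :: "('n \<Rightarrow> 'n \<Rightarrow> 'n \<Rightarrow> 'n \<Rightarrow> real) \<Rightarrow> 'n \<Rightarrow> 'n \<Rightarrow> 'n \<Rightarrow> 'n \<Rightarrow> real" where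
  "alt_pairs T A B C D = (T A B C D - T B A C D - T A B D C + T B A D C) / 4"

definition alt_four :: "('n \<Rightarrow> 'n \<Rightarrow> 'n \<Rightarrow> 'n \<Rightarrow> real) \<Rightarrow> 'n \<Rightarrow> 'n \<Rightarrow> 'n \<Rightarrow> 'n \<Rightarrow> real" where
  "alt_four T A B C D =
     (\<Sum>p | p permutes {..<4::nat}. of_int (sign p) *
        (let xs = permute_list p [A, B, C, D] in T (xs ! 0) (xs ! 1) (xs ! 2) (xs ! 3))) / 24"

definition phi_map ::
  "('n slot \<times> 'n slot \<times> 'n slot \<times> 'n slot \<times> 'c \<Rightarrow> real) \<Rightarrow> ('n list \<times> 'n list) \<times> 'c \<Rightarrow> real" where
  "phi_map w = (\<lambda>(z, c). case z of
       ([A, B], [C, D]) \<Rightarrow>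
         (let T = phi_contract w c
          in (alt_pairs T A B C D + alt_pairs T C D A B) / 2 - alt_four T A B C D)
     | _ \<Rightarrow> 0)"

text \<open>\<open>\<pi>\<close> is the projection \<open>\<V>\<^sub>2 \<otimes> \<V>\<^sub>k\<^sub>-\<^sub>2 \<rightarrow> \<V>\<^sub>k\<close>, which is determined only up to scale.\<close>

definition Phi_hom ::
  "((('n list \<times> 'n list) \<times> 'c \<Rightarrow> real) \<Rightarrow> 'd \<Rightarrow> real) \<Rightarrow> (('n, 'c) jc4 \<Rightarrow> real) \<Rightarrow> 'd \<Rightarrow> real" where
  "Phi_hom \<pi> j = \<pi> (phi_map (top_proj j))"

end

theory Submission
  imports Defs "HOL-Library.Function_Algebras" "HOL-Library.Multiset" "HOL-Combinatorics.Permutations"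
begin

text \<open>
  Let \<open>\<Psi>\<close> extend \<open>\<Phi>\<close>, let \<open>T = [c, d, \<dots>]\<close> be \<open>k\<close> distinct indices, and look at the component of \<open>\<Psi>\<close> at
  \<open>(T, T)\<close>. Since \<open>\<gg>\<^sub>1\<close> acts trivially on \<open>\<V>\<^sub>k\<close>, \<open>\<Psi>\<close> kills \<open>Z \<cdot> j\<close> for every semi-holonomic jet \<open>j\<close> of degree 3.
  If the coefficient \<open>u \<in> \<V>\<^sub>k\<^sub>-\<^sub>2\<close> involves only indices of \<open>T\<close> other than \<open>c, d\<close>, all contributions of \<open>u\<close> to
  this relation cancel, and it becomes a linear relation for an \<open>sl(2) \<times> sl(2)\<close>-invariant functional on
  \<open>\<otimes>\<^sup>4 (\<real>\<^sup>2 \<otimes> \<langle>e\<^sub>c, e\<^sub>d\<rangle>)\<close>. Modulo invariance one such relation already says that the functional vanishes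
  on the fourth power of the linear form \<open>l = x\<^sub>0\<^sub>c + x\<^sub>1\<^sub>d\<close>. But \<open>l\<^sup>4 u\<close> is a holonomic jet, on which \<open>\<Phi>\<close> is a
  nonzero multiple of \<open>\<pi> ((e\<^sub>c \<and> e\<^sub>d)\<^sup>2 \<otimes> u)\<close>. Invariance of \<open>\<pi>\<close> under replacing \<open>e\<^sub>c\<close> and \<open>e\<^sub>d\<close> by arbitrary
  basis vectors then makes the \<open>(T, T)\<close> component of \<open>\<pi>\<close> vanish identically, so \<open>\<pi>\<close> is not onto.
\<close>

subsection \<open>The action on 1-jets\<close>

text \<open>
  Each component of an action sees finitely many components of its argument, even though the
  index type of coordinates is infinite; this is what makes the derivatives in the definition of
  \<open>J1_mod\<close> computable.
\<close>

inductive fin_bilinear :: "('n::finite gmat \<Rightarrow> ('c \<Rightarrow> real) \<Rightarrow> real) \<Rightarrow> bool" where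
  coord: "linear K \<Longrightarrow> fin_bilinear (\<lambda>M u. K M * u d)"
| add: "fin_bilinear F \<Longrightarrow> fin_bilinear G \<Longrightarrow> fin_bilinear (\<lambda>M u. F M u + G M u)"

lemma fin_bilinear_zero: "fin_bilinear (\<lambda>M u. 0)"
  using coord[of "\<lambda>_. 0"] by (simp add: linear_zero)

lemma fin_bilinear_minus: "fin_bilinear F \<Longrightarrow> fin_bilinear (\<lambda>M u. - F M u)"
proof (induction rule: fin_bilinear.induct)
  case (coord K d)
  from coord have "linear (\<lambda>M. - K M)" by (rule linear_compose_neg)
  from fin_bilinear.coord[OF this, of d] show ?case by simp
next
  case (add F G)
  from fin_bilinear.add[OF add.IH] show ?case by simp
qed

lemma fin_bilinear_diff:
  "fin_bilinear F \<Longrightarrow> fin_bilinear G \<Longrightarrow> fin_bilinear (\<lambda>M u. F M u - G M u)"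
  using add[of F "\<lambda>M u. - G M u"] fin_bilinear_minus[of G] by simp

lemma fin_bilinear_sum:
  "(\<And>i. i \<in> I \<Longrightarrow> fin_bilinear (F i)) \<Longrightarrow> fin_bilinear (\<lambda>M u. \<Sum>i\<in>I. F i M u)"
proof (induction I rule: infinite_finite_induct)
  case (insert i I)
  from add[of "F i", OF insert.prems insert.IH] insert show ?case by simp
qed (simp_all add: fin_bilinear_zero)

lemma fin_bilinear_precomp:
  "fin_bilinear F \<Longrightarrow> linear L \<Longrightarrow> fin_bilinear (\<lambda>M u. F (L M) u)"
proof (induction rule: fin_bilinear.induct)
  case (coord K d)
  then have "linear (\<lambda>M. K (L M))" using linear_compose[of L K] by (simp add: o_def)
  then show ?case by (rule fin_bilinear.coord)
next
  case (add F G)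
  from fin_bilinear.add[OF add.IH[OF add.prems]] show ?case .
qed

lemma fin_bilinear_reindex:
  "fin_bilinear F \<Longrightarrow> fin_bilinear (\<lambda>M j. F M (\<lambda>c. j (g c)))"
proof (induction rule: fin_bilinear.induct)
  case (coord K d)
  then show ?case by (rule fin_bilinear.coord)
next
  case (add F G)
  from fin_bilinear.add[OF add.IH] show ?case .
qed

lemma fin_bilinear_add_right: "fin_bilinear F \<Longrightarrow> F M (u + v) = F M u + F M v"
  by (induction rule: fin_bilinear.induct) (auto simp: algebra_simps)

lemma fin_bilinear_zero_right: "fin_bilinear F \<Longrightarrow> F M (\<lambda>c. 0) = 0"
  by (induction rule: fin_bilinear.induct) auto

lemma fin_bilinear_scale_right: "fin_bilinear F \<Longrightarrow> F M (\<lambda>c. u c * r) = F M u * r"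
  by (induction rule: fin_bilinear.induct) (auto simp: algebra_simps)

lemma fin_bilinear_diff_left: "fin_bilinear F \<Longrightarrow> F (M - N) u = F M u - F N u"
  by (induction rule: fin_bilinear.induct) (auto simp: algebra_simps linear_diff)

lemma fin_bilinear_add_left: "fin_bilinear F \<Longrightarrow> F (M + N) u = F M u + F N u"
  by (induction rule: fin_bilinear.induct) (auto simp: algebra_simps linear_add)

lemma fin_bilinear_zero_left: "fin_bilinear F \<Longrightarrow> F 0 u = 0"
  by (induction rule: fin_bilinear.induct) (auto simp: linear_0)

text \<open>Product rule. As \<open>F\<close> reads only finitely many coordinates of its second
  argument, it is enough that each coordinate of \<open>B\<close> is differentiable.\<close>

lemma fin_bilinear_has_derivative:
  assumes "fin_bilinear F" "(A has_derivative A') (at x)"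
    and "\<And>c. ((\<lambda>y. B y c) has_derivative (\<lambda>h. B' h c)) (at x)"
  shows "((\<lambda>y. F (A y) (B y)) has_derivative (\<lambda>h. F (A x) (B' h) + F (A' h) (B x))) (at x)"
  using assms(1)
proof (induction rule: fin_bilinear.induct)
  case (coord K d)
  then have "bounded_linear K" by (simp add: linear_linear)
  from has_derivative_mult[OF bounded_linear.has_derivative[OF this assms(2)] assms(3)]
  show ?case .
next
  case (add F G)
  have "(\<lambda>h. F (A x) (B' h) + G (A x) (B' h) + (F (A' h) (B x) + G (A' h) (B x)))
      = (\<lambda>h. F (A x) (B' h) + F (A' h) (B x) + (G (A x) (B' h) + G (A' h) (B x)))"
    by (simp add: algebra_simps)
  with has_derivative_add[OF add.IH] show ?case by simp
qed

definition fin_module :: "('n::finite, 'c) gmodule \<Rightarrow> bool" where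
  "fin_module W \<longleftrightarrow> (\<forall>c. fin_bilinear (\<lambda>M u. act W M u c))"

section \<open>Block projections and differentiation of the conjugated matrix\<close>

lemma linear_gm_embed: "linear gm_embed"
  by (rule linearI) (auto simp: gm_embed_def vec_eq_iff split: sum.splits)

lemma linear_gm_part: "linear gm_part"
  by (rule linearI) (auto simp: gm_part_def vec_eq_iff)

lemma linear_p_part: "linear p_part"
  unfolding p_part_def
  by (intro linear_compose_sub linear_ident linear_compose[OF linear_gm_part linear_gm_embed, unfolded o_def])

lemma bilinear_matrix_mul:
  "bilinear ((**) :: real^'m^'k::finite \<Rightarrow> real^'l^'m::finite \<Rightarrow> real^'l^'k)"
  unfolding bilinear_def
  by (auto intro!: linearI simp: matrix_matrix_mult_def vec_eq_iff sum.distrib sum_distrib_left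
      algebra_simps)

definition bracket :: "'n::finite gmat \<Rightarrow> 'n gmat \<Rightarrow> 'n gmat" where
  "bracket M N = M ** N - N ** M"

lemma linear_bracket: "linear (\<lambda>M. bracket M N)"
  using bilinear_matrix_mul unfolding bracket_def bilinear_def
  by (intro linear_compose_sub) auto

text \<open>To first order in \<open>x\<close> the product is \<open>M + M x - x M\<close>. This is
  how the Lie bracket enters the action on 1-jets.\<close>

lemma conjugate_has_derivative:
  fixes M :: "'n::finite gmat"
  shows "((\<lambda>x. (mat 1 - gm_embed x) ** M ** (mat 1 + gm_embed x)) has_derivative
     (\<lambda>x. bracket M (gm_embed x))) (at 0)"
proof -
  interpret mm: bounded_bilinear "(**) :: 'n gmat \<Rightarrow> 'n gmat \<Rightarrow> 'n gmat"
    using bilinear_matrix_mul bilinear_conv_bounded_bilinear by blast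
  have e: "bounded_linear (gm_embed :: 'n gminus \<Rightarrow> _)" by (simp add: linear_gm_embed linear_linear)
  have [simp]: "gm_embed (0::'n gminus) = 0" by (rule linear_0[OF linear_gm_embed])
  note de = bounded_linear_imp_has_derivative[OF e]
  have d: "((\<lambda>x. (mat 1 - gm_embed x) ** M) has_derivative
      (\<lambda>x. (mat 1 - gm_embed 0) ** 0 + (0 - gm_embed x) ** M)) (at 0)"
    by (rule mm.FDERIV[OF has_derivative_diff[OF has_derivative_const de] has_derivative_const])
  show ?thesis
    using mm.FDERIV[OF d has_derivative_add[OF has_derivative_const de], of "mat 1"]
    by (simp add: bracket_def mm.minus_left mm.zero_right)
qed

definition slot_coord :: "'n::finite slot \<Rightarrow> 'n gminus \<Rightarrow> real" where
  "slot_coord s x = x $ snd s $ fst s"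

lemma linear_slot_coord: "linear (slot_coord s)"
  by (rule linearI) (auto simp: slot_coord_def)

lemma slot_coord_gm_basis: "slot_coord s (gm_basis s') = of_bool (s = s')"
  by (auto simp: slot_coord_def gm_basis_def axis_def split: prod.splits)

lemma sum_slot_coord_gm_basis:
  "(\<Sum>s'\<in>UNIV. slot_coord s' (gm_basis s) * j (Some s', c)) = (j (Some s, c) :: real)"
proof -
  have "(\<Sum>s'\<in>UNIV. slot_coord s' (gm_basis s) * j (Some s', c))
      = (\<Sum>s'\<in>UNIV. if s' = s then j (Some s', c) else 0)"
    by (intro sum.cong) (auto simp: slot_coord_gm_basis)
  then show ?thesis by simp
qed

lemma affine_section_eq:
  "affine_section j x c = j (None, c) + (\<Sum>s\<in>UNIV. slot_coord s x * j (Some s, c))"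
  by (auto simp: affine_section_def slot_coord_def intro!: sum.cong split: prod.splits)

lemma affine_section_has_derivative:
  "((\<lambda>y. affine_section j y c) has_derivative (\<lambda>h. \<Sum>s\<in>UNIV. slot_coord s h * j (Some s, c))) (at x)"
  unfolding affine_section_eq using linear_slot_coord
  by (auto intro!: derivative_eq_intros bounded_linear_imp_has_derivative simp: linear_linear)

definition gm_slot :: "'n::finite slot \<Rightarrow> 'n gmat" where
  "gm_slot s = gm_embed (gm_basis s)"

text \<open>Both formulas come from \<open>section_act\<close> on the affine representative, by
  evaluating and by differentiating at the origin. The representative has constant derivative, so in
  the transport term only the conjugated matrix gets differentiated.\<close>

lemma J1_act:
  fixes W :: "('n::finite, 'c) gmodule"
  assumes "fin_module W"
  shows "act (J1_mod W) M j (None, c) = act W (p_part M) (\<lambda>c. j (None, c)) c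
           - (\<Sum>s\<in>UNIV. slot_coord s (gm_part M) * j (Some s, c))"
    and "act (J1_mod W) M j (Some s, c) = act W (p_part M) (\<lambda>c. j (Some s, c)) c
           + act W (p_part (bracket M (gm_slot s))) (\<lambda>c. j (None, c)) c
           - (\<Sum>s'\<in>UNIV. slot_coord s' (gm_part (bracket M (gm_slot s))) * j (Some s', c))"
proof -
  let ?h = "\<lambda>x. (mat 1 - gm_embed x) ** M ** (mat 1 + gm_embed x)"
  let ?D = "\<lambda>v c. \<Sum>s\<in>UNIV. slot_coord s v * j (Some s, c)"
  have h0: "?h 0 = M" by (simp add: linear_0[OF linear_gm_embed])
  have a0: "affine_section j 0 = (\<lambda>c. j (None, c))"
    by (simp add: affine_section_eq fun_eq_iff linear_0[OF linear_slot_coord])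
  have sa: "section_act W M (affine_section j) x c
      = act W (p_part (?h x)) (affine_section j x) c - ?D (gm_part (?h x)) c" for x c
    unfolding section_act_def Let_def
    using frechet_derivative_at[OF affine_section_has_derivative[of j c x]]
    by (simp add: fun_eq_iff)
  show "act (J1_mod W) M j (None, c) = act W (p_part M) (\<lambda>c. j (None, c)) c
      - (\<Sum>s\<in>UNIV. slot_coord s (gm_part M) * j (Some s, c))"
    using sa[of 0 c] h0 a0 by (simp add: J1_mod_def jet1_def)
  have F: "fin_bilinear (\<lambda>M u. act W M u c)" using assms by (simp add: fin_module_def)
  have d1: "((\<lambda>x. p_part (?h x)) has_derivative (\<lambda>v. p_part (bracket M (gm_embed v)))) (at 0)"
    by (intro bounded_linear.has_derivative[OF _ conjugate_has_derivative])
      (simp add: linear_p_part linear_linear)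
  have "linear (\<lambda>x. ?D (gm_part x) c)"
    by (intro linear_compose_sum ballI)
      (rule linearI; simp add: linear_add[OF linear_gm_part] linear_add[OF linear_slot_coord]
        linear_scale[OF linear_gm_part] linear_scale[OF linear_slot_coord] algebra_simps)
  then have d2: "((\<lambda>x. ?D (gm_part (?h x)) c) has_derivative (\<lambda>v. ?D (gm_part (bracket M (gm_embed v))) c)) (at 0)"
    by (intro bounded_linear.has_derivative[OF _ conjugate_has_derivative, where f = "\<lambda>x. ?D (gm_part x) c"])
      (simp add: linear_linear)
  have "((\<lambda>x. section_act W M (affine_section j) x c) has_derivative
      (\<lambda>v. act W (p_part (?h 0)) (?D v) c + act W (p_part (bracket M (gm_embed v))) (affine_section j 0) c
         - ?D (gm_part (bracket M (gm_embed v))) c)) (at 0)"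
    unfolding sa
    by (rule has_derivative_diff[OF fin_bilinear_has_derivative[OF F d1 affine_section_has_derivative] d2])
  from frechet_derivative_at[OF this, symmetric]
  have "act (J1_mod W) M j (Some s, c) = act W (p_part M) (?D (gm_basis s)) c
      + act W (p_part (bracket M (gm_slot s))) (\<lambda>c. j (None, c)) c
      - ?D (gm_part (bracket M (gm_slot s))) c"
    unfolding h0 a0 by (simp add: J1_mod_def jet1_def partial_deriv_def gm_slot_def)
  then show "act (J1_mod W) M j (Some s, c) = act W (p_part M) (\<lambda>c. j (Some s, c)) c
      + act W (p_part (bracket M (gm_slot s))) (\<lambda>c. j (None, c)) c
      - ?D (gm_part (bracket M (gm_slot s))) c"
    unfolding sum_slot_coord_gm_basis .
qed

lemma fin_module_J1:
  assumes "fin_module W" shows "fin_module (J1_mod W)"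
  unfolding fin_module_def
proof
  fix x
  have W: "fin_bilinear (\<lambda>M u. act W M u c)" for c using assms by (simp add: fin_module_def)
  have lin: "linear (\<lambda>M. slot_coord s (gm_part (L M)))" if "linear L" for s and L :: "'a gmat \<Rightarrow> 'a gmat"
    by (rule linear_compose[OF linear_compose[OF that linear_gm_part] linear_slot_coord, unfolded o_def])
  have a: "fin_bilinear (\<lambda>M u. act W (L M) (\<lambda>d. u (z, d)) c)" if "linear L"
    for L :: "'a gmat \<Rightarrow> 'a gmat" and z c
    using fin_bilinear_precomp[OF fin_bilinear_reindex[OF W] that] .
  note lp = linear_compose[OF linear_bracket linear_p_part, unfolded o_def]
  have "fin_bilinear (\<lambda>M u. act (J1_mod W) M u (z, c))" for z c
  proof (cases z)
    case None
    show ?thesis unfolding None J1_act(1)[OF assms]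
      by (rule fin_bilinear_diff[OF a[OF linear_p_part] fin_bilinear_sum[OF coord[OF lin[OF linear_ident]]]])
  next
    case (Some s)
    show ?thesis unfolding Some J1_act(2)[OF assms]
      by (rule fin_bilinear_diff[OF fin_bilinear.add[OF a[OF linear_p_part] a[OF lp]]
            fin_bilinear_sum[OF coord[OF lin[OF linear_bracket]]]])
  qed
  then show "fin_bilinear (\<lambda>M u. act (J1_mod W) M u x)" by (metis surj_pair)
qed

lemma act_semihol_step [simp]: "act (semihol_step W) = act (J1_mod W)"
  by (simp add: semihol_step_def)

lemma fin_module_semihol_step: "fin_module W \<Longrightarrow> fin_module (semihol_step W)"
  using fin_module_J1[of W] unfolding fin_module_def act_semihol_step .

lemma V_mod_act:
  "act (V_mod k) M t (as, bs) = real k * (\<Sum>A'\<in>UNIV. M $ Inl A' $ Inl A') * t (as, bs)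
     - (\<Sum>i<k. \<Sum>C\<in>UNIV. M $ Inr C $ Inr (as ! i) * t (as[i := C], bs))
     - (\<Sum>i<k. \<Sum>C\<in>UNIV. M $ Inr C $ Inr (bs ! i) * t (as, bs[i := C]))"
  by (simp add: V_mod_def)

lemma fin_module_V_mod: "fin_module (V_mod k)"
proof -
  have lin: "linear (\<lambda>M. M $ i $ j)" for i j :: "2 + 'a" by (rule linearI) auto
  have lin': "linear (\<lambda>M :: 'a gmat. real k * (\<Sum>A'\<in>UNIV. M $ Inl A' $ Inl A'))"
    by (rule linearI) (auto simp: sum.distrib sum_distrib_left algebra_simps)
  have "fin_bilinear (\<lambda>M u. act (V_mod k) M u (as, bs))" for as bs :: "'a list"
    unfolding V_mod_act
    by (rule fin_bilinear_diff[OF fin_bilinear_diff[OF coord[OF lin']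
            fin_bilinear_sum[OF fin_bilinear_sum[OF coord[OF lin]]]]
            fin_bilinear_sum[OF fin_bilinear_sum[OF coord[OF lin]]]])
  then show ?thesis by (auto simp: fin_module_def)
qed

subsection \<open>Matrix units\<close>

definition matrix_unit :: "2 + 'n \<Rightarrow> 2 + 'n \<Rightarrow> 'n::finite gmat" where
  "matrix_unit i j = (\<chi> r c. of_bool (r = i \<and> c = j))"

abbreviation P_unit :: "2 \<Rightarrow> 2 \<Rightarrow> 'n::finite gmat" where
  "P_unit q p \<equiv> matrix_unit (Inl q) (Inl p)"

text \<open>The sign is chosen so that \<open>N_unit C a\<close> maps the basis vector \<open>e\<^sub>C\<close> of \<open>F\<close> to \<open>e\<^sub>a\<close>.\<close>

abbreviation N_unit :: "'n \<Rightarrow> 'n \<Rightarrow> 'n::finite gmat" where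
  "N_unit C a \<equiv> - matrix_unit (Inr C) (Inr a)"

abbreviation Z_unit :: "2 \<Rightarrow> 'n \<Rightarrow> 'n::finite gmat" where
  "Z_unit z a \<equiv> matrix_unit (Inl z) (Inr a)"

lemma matrix_unit_mul: "matrix_unit i j ** matrix_unit k l = (if j = k then matrix_unit i l else 0)"
proof -
  have "(\<Sum>m\<in>UNIV. of_bool (r = i \<and> m = j) * of_bool (m = k \<and> c = l))
      = (\<Sum>m\<in>UNIV. if m = j then of_bool (r = i \<and> j = k \<and> c = l) else (0 :: real))" for r c
    by (intro sum.cong) auto
  then show ?thesis
    by (auto simp: matrix_unit_def matrix_matrix_mult_def vec_eq_iff)
qed

lemma gm_slot_eq: "gm_slot s = matrix_unit (Inr (snd s)) (Inl (fst s))"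
  by (auto simp: gm_slot_def gm_embed_def gm_basis_def matrix_unit_def axis_def vec_eq_iff
      split: sum.splits prod.splits)

lemma gm_part_matrix_unit [simp]:
  "gm_part (matrix_unit (Inl p) j) = 0" "gm_part (matrix_unit i (Inr a)) = 0"
  "gm_part (matrix_unit (Inr C) (Inl p)) = gm_basis (p, C)"
  by (auto simp: gm_part_def matrix_unit_def gm_basis_def axis_def vec_eq_iff)

lemma p_part_if: "gm_part M = 0 \<Longrightarrow> p_part M = M"
  by (simp add: p_part_def linear_0[OF linear_gm_embed])

lemma p_part_matrix_unit [simp]:
  "p_part (matrix_unit (Inl p) j) = matrix_unit (Inl p) j"
  "p_part (matrix_unit i (Inr a)) = matrix_unit i (Inr a)"
  "p_part (matrix_unit (Inr C) (Inl p)) = 0"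
proof -
  show "p_part (matrix_unit (Inr C) (Inl p)) = 0"
    using gm_slot_eq[of "(p, C)"] by (simp add: p_part_def gm_slot_def)
qed (simp_all add: p_part_if)

lemma parts_gm_slot [simp]: "gm_part (gm_slot s) = gm_basis s" "p_part (gm_slot s) = 0"
  by (simp_all add: gm_slot_eq)

lemmas linear_minus_parts =
  linear_neg[OF linear_gm_part] linear_neg[OF linear_p_part] linear_neg[OF linear_slot_coord]
lemmas linear_diff_parts = linear_diff[OF linear_gm_part] linear_diff[OF linear_p_part]
lemmas linear_zero_parts =
  linear_0[OF linear_gm_part] linear_0[OF linear_p_part] linear_0[OF linear_slot_coord]

lemma matrix_minus_mul:
  fixes M N :: "'n::finite gmat"
  shows "(- M) ** N = - (M ** N)" "M ** (- N) = - (M ** N)"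
  by (simp_all add: matrix_matrix_mult_def vec_eq_iff sum_negf)

lemma bracket_P_unit:
  "bracket (P_unit q p) (gm_slot s) = - (if fst s = q then gm_slot (p, snd s) else 0)"
  by (auto simp: bracket_def gm_slot_eq matrix_unit_mul)

lemma bracket_N_unit:
  "bracket (N_unit C a) (gm_slot s) = - (if snd s = a then gm_slot (fst s, C) else 0)"
  by (auto simp: bracket_def gm_slot_eq matrix_unit_mul matrix_minus_mul)

text \<open>The bracket of the positive with the negative part lies in the grade-zero part, with one
  term in each diagonal block. Through \<open>J1_act\<close> these two terms turn the value of a jet
  into derivative components.\<close>

lemma bracket_Z_unit:
  "bracket (Z_unit z a) (gm_slot s)
     = (if snd s = a then P_unit z (fst s) else 0) - (if fst s = z then - N_unit (snd s) a else 0)"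
  by (auto simp: bracket_def gm_slot_eq matrix_unit_mul)

section \<open>Matrix units acting on 1-jets\<close>

context
  fixes W :: "('n::finite, 'c) gmodule"
  assumes W: "fin_module W"
begin

lemma act_linear:
  "act W M (u + v) = act W M u + act W M v" "act W M 0 = 0" "act W M (\<lambda>c. 0) = 0"
  "act W (M + N) u = act W M u + act W N u" "act W (M - N) u = act W M u - act W N u"
  "act W 0 u = 0" "act W (- M) u = - act W M u"
proof -
  have B: "fin_bilinear (\<lambda>M u. act W M u c)" for c using W by (simp add: fin_module_def)
  show 0: "act W 0 u = 0" using fin_bilinear_zero_left[OF B] by (simp add: fun_eq_iff)
  show d: "act W (M - N) u = act W M u - act W N u" for M N
    using fin_bilinear_diff_left[OF B] by (simp add: fun_eq_iff)
  from d[of 0 M] 0 show "act W (- M) u = - act W M u" by simp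
  show "act W M 0 = 0" "act W M (\<lambda>c. 0) = 0"
    using fin_bilinear_zero_right[OF B] by (simp_all add: fun_eq_iff zero_fun_def)
qed (use W fin_bilinear_add_right fin_bilinear_add_left in
      \<open>fastforce simp: fin_module_def fun_eq_iff\<close>)+

lemma J1_act_P_unit:
  "act (J1_mod W) (P_unit q p) j (None, c) = act W (P_unit q p) (\<lambda>c. j (None, c)) c"
  "act (J1_mod W) (P_unit q p) j (Some s, c) = act W (P_unit q p) (\<lambda>c. j (Some s, c)) c
     + (if fst s = q then j (Some (p, snd s), c) else 0)"
  using sum_slot_coord_gm_basis[of "(p, snd s)" j c]
  by (auto simp: J1_act[OF W] bracket_P_unit linear_minus_parts linear_zero_parts act_linear
      sum_negf)

lemma J1_act_N_unit:
  "act (J1_mod W) (N_unit C a) j (None, c) = act W (N_unit C a) (\<lambda>c. j (None, c)) c"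
  "act (J1_mod W) (N_unit C a) j (Some s, c) = act W (N_unit C a) (\<lambda>c. j (Some s, c)) c
     + (if snd s = a then j (Some (fst s, C), c) else 0)"
  using sum_slot_coord_gm_basis[of "(fst s, C)" j c]
  by (auto simp: J1_act[OF W] bracket_N_unit linear_minus_parts linear_zero_parts act_linear
      sum_negf)

lemma J1_act_Z_unit:
  "act (J1_mod W) (Z_unit z a) j (None, c) = act W (Z_unit z a) (\<lambda>c. j (None, c)) c"
  "act (J1_mod W) (Z_unit z a) j (Some s, c) = act W (Z_unit z a) (\<lambda>c. j (Some s, c)) c
     + (if snd s = a then act W (P_unit z (fst s)) (\<lambda>c. j (None, c)) c else 0)
     + (if fst s = z then act W (N_unit (snd s) a) (\<lambda>c. j (None, c)) c else 0)"
  by (auto simp: J1_act[OF W] bracket_Z_unit linear_minus_parts linear_zero_parts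
      linear_diff_parts act_linear)

end

section \<open>Jets with a single nonzero component\<close>

definition jet_val :: "('c \<Rightarrow> real) \<Rightarrow> ('n, 'c) jc \<Rightarrow> real" where
  "jet_val j = (\<lambda>(z, c). if z = None then j c else 0)"

definition jet_dir :: "'n slot \<Rightarrow> ('c \<Rightarrow> real) \<Rightarrow> ('n, 'c) jc \<Rightarrow> real" where
  "jet_dir s j = (\<lambda>(z, c). if z = Some s then j c else 0)"

lemma jet_apply [simp]:
  "jet_val j (None, c) = j c" "jet_val j (Some s, c) = 0"
  "jet_dir s j (None, c) = 0" "jet_dir s j (Some s', c) = (if s' = s then j c else 0)"
  by (auto simp: jet_val_def jet_dir_def)

lemma jet_eqI:
  "(\<And>c. f (None, c) = g (None, c)) \<Longrightarrow> (\<And>s c. f (Some s, c) = g (Some s, c)) \<Longrightarrow> f = g"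
  by (rule ext) (metis surj_pair option.exhaust)

lemma jet_dir_linear [simp]:
  "jet_dir s (u + v) = jet_dir s u + jet_dir s v" "jet_dir s 0 = 0"
  "jet_dir s (u - v) = jet_dir s u - jet_dir s v"
  by (auto intro!: jet_eqI)

lemma sum_fun_apply: "(\<Sum>i\<in>I. f i) x = (\<Sum>i\<in>I. f i x)"
  by (induction I rule: infinite_finite_induct) auto

lemma jet_dir_sum: "jet_dir s (\<Sum>i\<in>I. f i) = (\<Sum>i\<in>I. jet_dir s (f i))"
  by (rule jet_eqI) (simp_all add: sum_fun_apply)

lemma act_P_jet_dir:
  assumes "fin_module W"
  shows "act (J1_mod W) (P_unit q p) (jet_dir s j) =
    jet_dir s (act W (P_unit q p) j) + (if fst s = p then jet_dir (q, snd s) j else 0)"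
  by (rule jet_eqI; cases s)
    (auto simp: J1_act_P_unit[OF assms] act_linear[OF assms] split: if_splits)

lemma act_N_jet_dir:
  assumes "fin_module W"
  shows "act (J1_mod W) (N_unit C a) (jet_dir s j) =
    jet_dir s (act W (N_unit C a) j) + (if snd s = C then jet_dir (fst s, a) j else 0)"
  by (rule jet_eqI; cases s)
    (auto simp: J1_act_N_unit[OF assms] act_linear[OF assms] split: if_splits)

text \<open>The extra terms in \<open>J1_act_Z_unit\<close> involve only the value of the jet, which
  is zero here.\<close>

lemma act_Z_jet_dir:
  assumes "fin_module W"
  shows "act (J1_mod W) (Z_unit z a) (jet_dir s j) = jet_dir s (act W (Z_unit z a) j)"
  by (rule jet_eqI) (auto simp: J1_act_Z_unit[OF assms] act_linear[OF assms])

text \<open>The two sums are the gl(2) and gl(n) terms of \<open>bracket_Z_unit\<close>, sorted by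
  the slot in which they appear. All monomials in \<open>relation_Z\<close> originate here.\<close>

lemma act_Z_jet_val:
  assumes "fin_module W"
  shows "act (J1_mod W) (Z_unit z a) (jet_val j) = jet_val (act W (Z_unit z a) j)
    + (\<Sum>p\<in>UNIV. jet_dir (p, a) (act W (P_unit z p) j))
    + (\<Sum>C\<in>UNIV. jet_dir (z, C) (act W (N_unit C a) j))"
proof (rule jet_eqI)
  fix s :: "'a slot" and c
  obtain p C where s: "s = (p, C)" by force
  have "(\<Sum>p'\<in>UNIV. jet_dir (p', a) (act W (P_unit z p') j) (Some s, c))
      = (\<Sum>p'\<in>UNIV. if p' = p then (if C = a then act W (P_unit z p) j c else 0) else 0)"
    by (rule sum.cong) (auto simp: s)
  moreover have "(\<Sum>C'\<in>UNIV. jet_dir (z, C') (act W (N_unit C' a) j) (Some s, c))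
      = (\<Sum>C'\<in>UNIV. if C' = C then (if p = z then act W (N_unit C a) j c else 0) else 0)"
    by (rule sum.cong) (auto simp: s)
  ultimately show "act (J1_mod W) (Z_unit z a) (jet_val j) (Some s, c) = (jet_val (act W (Z_unit z a) j)
      + (\<Sum>p\<in>UNIV. jet_dir (p, a) (act W (P_unit z p) j))
      + (\<Sum>C\<in>UNIV. jet_dir (z, C) (act W (N_unit C a) j))) (Some s, c)"
    by (simp add: J1_act_Z_unit[OF assms] act_linear[OF assms] sum_fun_apply s)
qed (simp add: J1_act_Z_unit[OF assms] sum_fun_apply)

text \<open>On basis tensors this replaces \<open>e\<^sub>C\<close> by \<open>e\<^sub>a\<close>, hence it reads components with \<open>a\<close> replaced by \<open>C\<close>.\<close>

definition replace_index ::
  "nat \<Rightarrow> 'n \<Rightarrow> 'n \<Rightarrow> ('n list \<times> 'n list \<Rightarrow> real) \<Rightarrow> 'n list \<times> 'n list \<Rightarrow> real" where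
  "replace_index k C a t = (\<lambda>(as, bs).
     (\<Sum>i<k. if as ! i = a then t (as[i := C], bs) else 0)
     + (\<Sum>i<k. if bs ! i = a then t (as, bs[i := C]) else 0))"

lemma matrix_unit_apply: "matrix_unit i j $ r $ c = of_bool (r = i \<and> c = j)"
  by (simp add: matrix_unit_def)

lemma V_mod_act_P_unit: "act (V_mod k) (P_unit q p) u = (\<lambda>z. if p = q then real k * u z else 0)"
proof -
  have "(\<Sum>A'\<in>UNIV. P_unit q p $ Inl A' $ Inl A') = (\<Sum>A'\<in>UNIV. if A' = p then of_bool (p = q) else (0 :: real))"
    by (rule sum.cong) (auto simp: matrix_unit_apply)
  then show ?thesis by (auto simp: V_mod_act matrix_unit_apply)
qed

lemma V_mod_act_N_unit: "act (V_mod k) (N_unit C a) u = replace_index k C a u"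
proof -
  have "(\<Sum>D\<in>UNIV. N_unit C a $ Inr D $ Inr x * f D) = (\<Sum>D\<in>UNIV. if D = C then (if x = a then - f D else 0) else (0 :: real))" for x and f :: "'a \<Rightarrow> real"
    by (rule sum.cong) (auto simp: matrix_unit_apply)
  moreover have 0: "N_unit C a $ Inl A' $ Inl A' = 0" for A'
    by (simp add: matrix_unit_apply)
  ultimately have "(\<Sum>D\<in>UNIV. N_unit C a $ Inr D $ Inr x * f D) = - (if x = a then f C else 0)" for x and f :: "'a \<Rightarrow> real"
    by simp
  then show ?thesis
    unfolding replace_index_def fun_eq_iff split_paired_All V_mod_act
    by (simp add: sum_negf 0 del: vector_uminus_component)
qed

lemma V_mod_act_Z_unit: "act (V_mod k) (Z_unit z a) u = 0"
  by (auto simp: V_mod_act matrix_unit_apply)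

subsection \<open>Young symmetrizers\<close>

lemma row_swap_length [simp]:
  "length (fst (row_swap k S z)) = k" "length (snd (row_swap k S z)) = k"
  by (auto simp: row_swap_def split: prod.splits)

text \<open>As a single finite linear combination the symmetrizer can be handled by linearity and by
  \<open>replace_index_sum\<close> in one step.\<close>

lemma young_symmetrizer_altdef:
  "young_symmetrizer k t (as, bs) = (if length as = k \<and> length bs = k
     then \<Sum>x\<in>{p. p permutes {..<k}} \<times> {p. p permutes {..<k}} \<times> Pow {..<k}.
       of_int (sign (fst x) * sign (fst (snd x)))
         * t (row_swap k (snd (snd x)) (permute_list (fst x) as, permute_list (fst (snd x)) bs))
     else 0)"
  by (simp add: young_symmetrizer_def sum_distrib_left sum.cartesian_product case_prod_unfold)

lemma young_symmetrizer_linear: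
  "young_symmetrizer k (\<lambda>z. \<Sum>i\<in>I. c i * t i z) = (\<lambda>z. \<Sum>i\<in>I. c i * young_symmetrizer k (t i) z)"
proof -
  have "young_symmetrizer k (\<lambda>z. \<Sum>i\<in>I. c i * t i z) (as, bs) = (\<Sum>i\<in>I. c i * young_symmetrizer k (t i) (as, bs))" for as bs
    by (cases "length as = k \<and> length bs = k")
      (auto simp: young_symmetrizer_altdef sum_distrib_left sum.swap[of _ I] mult.left_commute)
  then show ?thesis by auto
qed

lemma young_symmetrizer_eq_0:
  "length as \<noteq> k \<or> length bs \<noteq> k \<Longrightarrow> young_symmetrizer k t (as, bs) = 0"
  by (auto simp: young_symmetrizer_def)

lemma V_mod_lincomb:
  assumes "u \<in> vecs (V_mod k)" "v \<in> vecs (V_mod k)"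
  shows "(\<lambda>z. a * u z + b * v z) \<in> vecs (V_mod k)"
proof -
  obtain s t where "u = young_symmetrizer k s" "v = young_symmetrizer k t"
    using assms by (auto simp: V_mod_def)
  then have "(\<lambda>z. a * u z + b * v z)
      = young_symmetrizer k (\<lambda>z. \<Sum>i\<in>{True, False}. (if i then a else b) * (if i then s else t) z)"
    by (subst young_symmetrizer_linear) simp
  then show ?thesis by (auto simp: V_mod_def)
qed

lemma V_mod_zero: "(\<lambda>z. 0) \<in> vecs (V_mod k)" "0 \<in> vecs (V_mod k)"
proof -
  have "(\<lambda>z. 0) = young_symmetrizer k (\<lambda>z. \<Sum>i\<in>{}. i * i)"
    by (subst young_symmetrizer_linear) simp
  then show "(\<lambda>z. 0) \<in> vecs (V_mod k)" by (auto simp: V_mod_def)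
  then show "0 \<in> vecs (V_mod k)" by (simp add: zero_fun_def)
qed

text \<open>Composing with the transposition permutes the index set of the sum and reverses the
  sign, so the sum equals its own negative.\<close>

lemma sum_permutes_repeated:
  fixes f :: "(nat \<Rightarrow> nat) \<Rightarrow> real"
  assumes "i < k" "j < k" "i \<noteq> j"
    and "\<And>p. p permutes {..<k} \<Longrightarrow> f (Transposition.transpose i j \<circ> p) = f p"
  shows "(\<Sum>p | p permutes {..<k}. of_int (sign p) * f p) = 0"
proof -
  let ?t = "Transposition.transpose i j"
  have t: "?t permutes {..<k}" using assms by (simp add: permutes_swap_id)
  have "(\<Sum>p | p permutes {..<k}. of_int (sign p) * f p)
      = (\<Sum>p | p permutes {..<k}. of_int (sign (?t \<circ> p)) * f (?t \<circ> p))"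
    by (rule sum.reindex_bij_witness[of _ "\<lambda>p. ?t \<circ> p" "\<lambda>p. ?t \<circ> p"])
      (auto simp: o_assoc[symmetric] permutes_compose[OF _ t] o_assoc)
  also have "\<dots> = (\<Sum>p | p permutes {..<k}. - (of_int (sign p) * f p))"
  proof (rule sum.cong)
    fix p assume "p \<in> {p. p permutes {..<k}}"
    then have p: "p permutes {..<k}" by simp
    then have "sign (?t \<circ> p) = - sign p"
      using assms(3) sign_compose[of ?t p] permutation_permutes[THEN iffD2, of p]
      by (auto simp: sign_swap_id permutation_swap_id)
    then show "of_int (sign (?t \<circ> p)) * f (?t \<circ> p) = - (of_int (sign p) * f p)"
      using assms(4)[OF p] by simp
  qed simp
  also have "\<dots> = - (\<Sum>p | p permutes {..<k}. of_int (sign p) * f p)" by (simp add: sum_negf)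
  finally show ?thesis by simp
qed

lemma permute_list_transpose:
  assumes "i < length as" "j < length as" "as ! i = as ! j"
  shows "permute_list (Transposition.transpose i j \<circ> p) as = permute_list p as"
proof -
  have "as ! Transposition.transpose i j m = as ! m" for m
    using assms by (cases "m = i"; cases "m = j") auto
  then show ?thesis using assms by (simp add: permute_list_def)
qed

text \<open>Each column is alternated last, so \<open>sum_permutes_repeated\<close> applies to the
  column with two equal entries.\<close>

lemma young_symmetrizer_repeated:
  assumes "\<not> distinct as \<or> \<not> distinct bs"
  shows "young_symmetrizer k t (as, bs) = 0"
proof (cases "length as = k \<and> length bs = k")
  case True
  let ?f = "\<lambda>p q. \<Sum>S\<in>Pow {..<k}. t (row_swap k S (permute_list p as, permute_list q bs))"
  from assms show ?thesis
  proof
    assume "\<not> distinct as"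
    then obtain i j where ij: "i < k" "j < k" "i \<noteq> j" "as ! i = as ! j"
      using True by (auto simp: distinct_conv_nth)
    have "(\<Sum>p | p permutes {..<k}. of_int (sign p) * (\<Sum>q | q permutes {..<k}. of_int (sign q) * ?f p q)) = 0"
      using ij True by (intro sum_permutes_repeated[of i k j]) (auto simp: permute_list_transpose)
    then show ?thesis using True
      by (simp add: young_symmetrizer_def sum_distrib_left mult.assoc)
  next
    assume "\<not> distinct bs"
    then obtain i j where ij: "i < k" "j < k" "i \<noteq> j" "bs ! i = bs ! j"
      using True by (auto simp: distinct_conv_nth)
    have "(\<Sum>q | q permutes {..<k}. of_int (sign q) * ?f p q) = 0" for p
      using ij True by (intro sum_permutes_repeated[of i k j]) (auto simp: permute_list_transpose)
    then have "(\<Sum>p | p permutes {..<k}. of_int (sign p) * (\<Sum>q | q permutes {..<k}. of_int (sign q) * ?f p q)) = 0"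
      by simp
    then show ?thesis using True
      by (simp add: young_symmetrizer_def sum_distrib_left mult.assoc)
  qed
qed (simp add: young_symmetrizer_eq_0)

lemma V_mod_repeated:
  "u \<in> vecs (V_mod k) \<Longrightarrow> \<not> distinct as \<or> \<not> distinct bs \<Longrightarrow> u (as, bs) = 0"
  using young_symmetrizer_repeated by (fastforce simp: V_mod_def)

section \<open>Replacing an index commutes with the symmetrizer\<close>

lemma permute_list_update:
  assumes "p permutes {..<length as}" "i < length as"
  shows "permute_list p (as[p i := C]) = (permute_list p as)[i := C]"
proof (rule nth_equalityI)
  fix j assume j: "j < length (permute_list p (as[p i := C]))"
  have "p i < length as" "p j < length as" using assms j permutes_in_image[OF assms(1)] by auto
  moreover have "p i = p j \<longleftrightarrow> i = j" using permutes_inj[OF assms(1)] by (auto simp: inj_eq)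
  ultimately show "permute_list p (as[p i := C]) ! j = (permute_list p as)[i := C] ! j"
    using assms j by (auto simp: permute_list_nth nth_list_update)
qed simp

text \<open>Permuting a list only renames the positions over which the sum runs.\<close>

lemma sum_replace_permute_list:
  fixes g :: "'n list \<Rightarrow> real"
  assumes p: "p permutes {..<k}" "length as = k"
  shows "(\<Sum>i<k. if permute_list p as ! i = a then g ((permute_list p as)[i := C]) else 0)
       = (\<Sum>i<k. if as ! i = a then g (permute_list p (as[i := C])) else 0)"
proof -
  have "(\<Sum>i<k. if as ! i = a then g (permute_list p (as[i := C])) else 0)
      = (\<Sum>i<k. if as ! p i = a then g (permute_list p (as[p i := C])) else 0)"
    using sum.permute[OF p(1), of "\<lambda>i. if as ! i = a then g (permute_list p (as[i := C])) else 0"]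
    by (simp add: o_def)
  also have "\<dots> = (\<Sum>i<k. if permute_list p as ! i = a then g ((permute_list p as)[i := C]) else 0)"
    using p by (intro sum.cong) (auto simp: permute_list_nth permute_list_update)
  finally show ?thesis by simp
qed

lemma replace_index_permute:
  assumes "p permutes {..<k}" "q permutes {..<k}" "length as = k" "length bs = k"
  shows "replace_index k C a t (permute_list p as, permute_list q bs)
       = replace_index k C a (\<lambda>(as, bs). t (permute_list p as, permute_list q bs)) (as, bs)"
  using sum_replace_permute_list[OF assms(1,3), of a "\<lambda>as. t (as, permute_list q bs)"]
    sum_replace_permute_list[OF assms(2,4), of a "\<lambda>bs. t (permute_list p as, bs)"]
  unfolding replace_index_def split_conv by (simp cong: if_cong)

lemma row_swap_update:
  assumes "length as = k" "length bs = k" "i < k"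
  shows "row_swap k S (as[i := C], bs) = (let (cs, ds) = row_swap k S (as, bs) in
            if i \<in> S then (cs, ds[i := C]) else (cs[i := C], ds))"
    and "row_swap k S (as, bs[i := C]) = (let (cs, ds) = row_swap k S (as, bs) in
            if i \<in> S then (cs[i := C], ds) else (cs, ds[i := C]))"
  using assms by (auto simp: row_swap_def nth_list_update intro!: nth_equalityI)

text \<open>A row swap may move a replacement from one column to the other, but within the same row.
  The two column sums are therefore merged into one sum over rows before comparing terms.\<close>

lemma replace_index_row_swap:
  assumes "length as = k" "length bs = k"
  shows "replace_index k C a t (row_swap k S (as, bs)) = replace_index k C a (\<lambda>z. t (row_swap k S z)) (as, bs)"
  unfolding replace_index_def row_swap_update sum.distrib[symmetric]
  by (simp add: case_prod_unfold sum.distrib[symmetric], rule sum.cong, simp)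
    (use assms in \<open>simp add: row_swap_update case_prod_unfold Let_def, simp add: row_swap_def\<close>)

lemma replace_index_sum:
  fixes c :: "'i \<Rightarrow> real"
  shows
  "replace_index k C a (\<lambda>z. \<Sum>i\<in>I. c i * t i z) z = (\<Sum>i\<in>I. c i * replace_index k C a (t i) z)"
proof -
  obtain as bs where z: "z = (as, bs)" by force
  have d: "(if P then \<Sum>i\<in>I. f i else 0) = (\<Sum>i\<in>I. if P then f i else 0)" for P and f :: "'i \<Rightarrow> real"
    by simp
  show ?thesis
    unfolding z replace_index_def split_conv d sum.swap[of _ I] sum_distrib_left distrib_left sum.distrib
    by (simp add: if_distrib cong: if_cong)
qed

text \<open>A replacement treats all places of the tensor alike, hence commutes with permuting them.
  This is the gl(n)-equivariance that makes \<open>V_mod k\<close> stable under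
  \<open>replace_index\<close>.\<close>

lemma young_symmetrizer_replace_index:
  "replace_index k C a (young_symmetrizer k t) = young_symmetrizer k (replace_index k C a t)"
proof
  fix z :: "'a list \<times> 'a list"
  obtain as bs where z: "z = (as, bs)" by force
  show "replace_index k C a (young_symmetrizer k t) z = young_symmetrizer k (replace_index k C a t) z"
  proof (cases "length as = k \<and> length bs = k")
    case True
    let ?P = "{p. p permutes {..<k}}"
    let ?t = "\<lambda>p q S z. t (row_swap k S (permute_list p (fst z), permute_list q (snd z)))"
    have "replace_index k C a (young_symmetrizer k t) z
        = replace_index k C a (\<lambda>z. \<Sum>x\<in>?P \<times> ?P \<times> Pow {..<k}. of_int (sign (fst x) * sign (fst (snd x)))
            * ?t (fst x) (fst (snd x)) (snd (snd x)) z) z"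
      using True by (simp add: z replace_index_def young_symmetrizer_altdef cong: if_cong)
    also have "\<dots> = (\<Sum>x\<in>?P \<times> ?P \<times> Pow {..<k}. of_int (sign (fst x) * sign (fst (snd x)))
            * replace_index k C a (?t (fst x) (fst (snd x)) (snd (snd x))) z)"
      by (rule replace_index_sum)
    also have "\<dots> = (\<Sum>(p, q, S)\<in>?P \<times> ?P \<times> Pow {..<k}. of_int (sign p * sign q)
            * replace_index k C a t (row_swap k S (permute_list p as, permute_list q bs)))"
    proof (intro sum.cong refl, clarsimp)
      fix p q S assume "p permutes {..<k}" "q permutes {..<k}"
      then show "replace_index k C a (?t p q S) z = replace_index k C a t (row_swap k S (permute_list p as, permute_list q bs))"
        using True by (simp add: z replace_index_row_swap replace_index_permute case_prod_unfold)
    qed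
    also have "\<dots> = young_symmetrizer k (replace_index k C a t) z"
      using True by (simp add: z young_symmetrizer_altdef case_prod_unfold)
    finally show ?thesis .
  next
    case False
    then show ?thesis
      by (auto simp: z replace_index_def young_symmetrizer_eq_0 cong: if_cong)
  qed
qed

lemma V_mod_replace_index: "u \<in> vecs (V_mod k) \<Longrightarrow> replace_index k C a u \<in> vecs (V_mod k)"
  by (auto simp: V_mod_def young_symmetrizer_replace_index)

section \<open>Symmetrized basis tensors and their weights\<close>

definition unit_tensor :: "'n list \<times> 'n list \<Rightarrow> 'n list \<times> 'n list \<Rightarrow> real" where
  "unit_tensor z = (\<lambda>z'. of_bool (z' = z))"

definition list_pairs :: "nat \<Rightarrow> ('n list \<times> 'n list) set" where
  "list_pairs k = {as. length as = k} \<times> {bs. length bs = k}"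

lemma finite_list_pairs: "finite (list_pairs k :: ('n::finite list \<times> 'n list) set)"
  using finite_lists_length_eq[of "UNIV :: 'n set" k] by (simp add: list_pairs_def)

text \<open>Only components at pairs of lists of length \<open>k\<close> are read, so
  \<open>t\<close> may be truncated to a finite combination of basis tensors. Hence the symmetrized
  basis tensors span \<open>V_mod k\<close>.\<close>

lemma young_symmetrizer_expand:
  fixes t :: "'n::finite list \<times> 'n list \<Rightarrow> real"
  shows "young_symmetrizer k t = (\<lambda>z. \<Sum>w\<in>list_pairs k. t w * young_symmetrizer k (unit_tensor w) z)"
proof -
  define t' where "t' = (\<lambda>z. \<Sum>w\<in>list_pairs k. t w * unit_tensor w z)"
  have t': "t' w = t w" if "w \<in> list_pairs k" for w
  proof -
    have "t' w = (\<Sum>w'\<in>list_pairs k. if w' = w then t w' else 0)"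
      unfolding t'_def by (rule sum.cong) (auto simp: unit_tensor_def)
    also have "\<dots> = t w" using that by (simp add: finite_list_pairs)
    finally show ?thesis .
  qed
  have "row_swap k S w \<in> list_pairs k" for S and w :: "'n list \<times> 'n list"
    using row_swap_length[of k S w] by (auto simp: list_pairs_def mem_Times_iff)
  then have "young_symmetrizer k t = young_symmetrizer k t'"
    by (simp add: young_symmetrizer_def fun_eq_iff t')
  then show ?thesis by (simp only: t'_def young_symmetrizer_linear)
qed

lemma mset_row_swap:
  assumes "length as = k" "length bs = k" "row_swap k S (as, bs) = (cs, ds)"
  shows "mset cs + mset ds = mset as + mset bs"
proof -
  have m: "mset xs = (\<Sum>i<length xs. {#xs ! i#})" for xs :: "'a list"
    by (induction xs rule: rev_induct) (auto simp: nth_append)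
  have "mset cs + mset ds = (\<Sum>i<k. {#cs ! i#} + {#ds ! i#})"
    unfolding sum.distrib using assms row_swap_length[of k S "(as, bs)"] by (simp add: m)
  also have "\<dots> = (\<Sum>i<k. {#as ! i#} + {#bs ! i#})"
    using assms(3) by (intro sum.cong) (auto simp: row_swap_def)
  also have "\<dots> = mset as + mset bs"
    unfolding sum.distrib using assms by (simp add: m)
  finally show ?thesis .
qed

text \<open>Column permutations and row swaps rearrange entries without changing the joint multiset,
  so the symmetrized tensor is supported on a single weight.\<close>

lemma young_symmetrizer_unit_mset:
  assumes "young_symmetrizer k (unit_tensor (cs, ds)) (as, bs) \<noteq> 0"
  shows "mset as + mset bs = mset cs + mset ds"
proof (rule ccontr)
  assume neq: "\<not> ?thesis"
  have len: "length as = k" "length bs = k" using assms young_symmetrizer_eq_0 by metis+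
  have "row_swap k S (permute_list p as, permute_list q bs) \<noteq> (cs, ds)"
    if "p permutes {..<k}" "q permutes {..<k}" for p q S
    using mset_row_swap[of "permute_list p as" k "permute_list q bs" S cs ds] that len neq by auto
  then have "young_symmetrizer k (unit_tensor (cs, ds)) (as, bs) = 0"
    using len by (auto simp: young_symmetrizer_def unit_tensor_def intro!: sum.neutral)
  with assms show False by simp
qed

lemma sum_count_mset: "(\<Sum>i<length xs. if xs ! i = C then x else 0) = real (count (mset xs) C) * x"
proof -
  have "(\<Sum>i<length xs. if xs ! i = C then x else 0) = (\<Sum>y\<leftarrow>xs. if y = C then x else 0)"
    by (simp add: sum_list_sum_nth atLeast0LessThan)
  also have "\<dots> = real (count (mset xs) C) * x"
    by (induction xs) (auto simp: algebra_simps)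
  finally show ?thesis .
qed

text \<open>Symmetrized basis tensors are weight vectors: at a component the factor is the
  multiplicity of \<open>C\<close> in it, which is constant on the support by
  \<open>young_symmetrizer_unit_mset\<close>.\<close>

lemma replace_index_diagonal:
  "replace_index k C C (young_symmetrizer k (unit_tensor (cs, ds)))
    = (\<lambda>z. real (count (mset cs + mset ds) C) * young_symmetrizer k (unit_tensor (cs, ds)) z)"
proof
  fix z :: "'a list \<times> 'a list"
  obtain as bs where z: "z = (as, bs)" by force
  let ?u = "young_symmetrizer k (unit_tensor (cs, ds))"
  have up: "xs ! i = C \<Longrightarrow> xs[i := C] = xs" for xs i by auto
  have r: "replace_index k C C ?u z = (\<Sum>i<k. if as ! i = C then ?u z else 0) + (\<Sum>i<k. if bs ! i = C then ?u z else 0)"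
    unfolding z replace_index_def split_conv by (intro arg_cong2[where f = "(+)"] sum.cong refl) (simp_all add: up)
  show "replace_index k C C ?u z = real (count (mset cs + mset ds) C) * ?u z"
  proof (cases "?u z = 0")
    case False
    then have len: "length as = k" "length bs = k" and m: "mset as + mset bs = mset cs + mset ds"
      using young_symmetrizer_eq_0[of as k bs] young_symmetrizer_unit_mset[of k cs ds as bs] unfolding z by metis+
    show ?thesis
      unfolding r m[symmetric] using len sum_count_mset[of as C "?u z"] sum_count_mset[of bs C "?u z"]
      by (simp add: algebra_simps)
  qed (simp add: r cong: if_cong)
qed

text \<open>Every component that is read contains \<open>C\<close>, hence lies outside the support
  of the tensor.\<close>

lemma replace_index_unit_absent:
  assumes "C \<notin> set cs" "C \<notin> set ds"
  shows "replace_index k C a (young_symmetrizer k (unit_tensor (cs, ds))) = 0"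
proof
  fix z :: "'a list \<times> 'a list"
  obtain as bs where z: "z = (as, bs)" by force
  let ?u = "young_symmetrizer k (unit_tensor (cs, ds))"
  have 0: "?u (as', bs') = 0" if "C \<in> set as' \<or> C \<in> set bs'" for as' bs'
    using young_symmetrizer_unit_mset[of k cs ds as' bs'] assms that
    by (metis set_mset_mset union_iff)
  have "?u (as[i := C], bs) = 0" if "i < k" for i
    using 0[of "as[i := C]" bs] young_symmetrizer_eq_0[of "as[i := C]" k bs] that
    by (metis length_list_update set_update_memI)
  moreover have "?u (as, bs[i := C]) = 0" if "i < k" for i
    using 0[of as "bs[i := C]"] young_symmetrizer_eq_0[of as k "bs[i := C]"] that
    by (metis length_list_update set_update_memI)
  ultimately show "replace_index k C a ?u z = 0 z"
    by (simp add: z replace_index_def cong: if_cong)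
qed

subsection \<open>Semi-holonomic jets of degrees 3 and 4\<close>

lemma matrix_unit_in_p_alg:
  "p \<noteq> q \<Longrightarrow> P_unit q p \<in> p_alg" "a \<noteq> C \<Longrightarrow> N_unit C a \<in> p_alg" "Z_unit z a \<in> p_alg"
  by (auto simp: p_alg_def trace_def matrix_unit_apply sum_negf of_bool_conj)

lemma g0_algI: "M \<in> p_alg \<Longrightarrow> (\<forall>A' A. M $ Inl A' $ Inr A = 0) \<Longrightarrow> M \<in> g0_alg"
  by (simp add: g0_alg_def)

definition monomial_jet ::
  "'n slot \<Rightarrow> 'n slot \<Rightarrow> 'n slot \<Rightarrow> 'n slot \<Rightarrow> ('c \<Rightarrow> real) \<Rightarrow> ('n, 'c) jc4 \<Rightarrow> real" where
  "monomial_jet s1 s2 s3 s4 u = jet_dir s1 (jet_dir s2 (jet_dir s3 (jet_dir s4 u)))"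

text \<open>Semi-holonomicity forces the same component for all four positions of the single \<open>None\<close>.\<close>

definition cubic_jet ::
  "'n slot \<Rightarrow> 'n slot \<Rightarrow> 'n slot \<Rightarrow> ('c \<Rightarrow> real) \<Rightarrow> ('n, 'c) jc4 \<Rightarrow> real" where
  "cubic_jet s1 s2 s3 u = jet_val (jet_dir s1 (jet_dir s2 (jet_dir s3 u)))
     + jet_dir s1 (jet_val (jet_dir s2 (jet_dir s3 u))
     + jet_dir s2 (jet_val (jet_dir s3 u) + jet_dir s3 (jet_val u)))"

section \<open>Membership in the semi-holonomic jets\<close>

lemma jet_val_linear [simp]: "jet_val (u + v) = jet_val u + jet_val v" "jet_val 0 = 0"
  by (auto intro!: jet_eqI)

lemma jet_proj_simps [simp]:
  "jet_proj (jet_val j) = j" "jet_proj (jet_dir s j) = 0" "jet_proj (f + g) = jet_proj f + jet_proj g"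
  "jet_proj (\<lambda>c. 0) = (\<lambda>c. 0)" "jet_proj 0 = 0"
  by (auto simp: jet_proj_def)

lemma jet_map_simps [simp]:
  "jet_map jet_proj (jet_val j) = jet_val (jet_proj j)"
  "jet_map jet_proj (jet_dir s j) = jet_dir s (jet_proj j)"
  "jet_map jet_proj (f + g) = jet_map jet_proj f + jet_map jet_proj g"
  "jet_map jet_proj 0 = 0"
  by (auto simp: jet_map_def jet_proj_def jet_val_def jet_dir_def fun_eq_iff)

definition subspace_module :: "('n::finite, 'c) gmodule \<Rightarrow> bool" where
  "subspace_module W \<longleftrightarrow> 0 \<in> vecs W \<and> (\<forall>u\<in>vecs W. \<forall>v\<in>vecs W. u + v \<in> vecs W)"

lemma subspace_moduleD:
  "subspace_module W \<Longrightarrow> 0 \<in> vecs W" "subspace_module W \<Longrightarrow> (\<lambda>c. 0) \<in> vecs W"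
  "subspace_module W \<Longrightarrow> u \<in> vecs W \<Longrightarrow> v \<in> vecs W \<Longrightarrow> u + v \<in> vecs W"
  by (auto simp: subspace_module_def zero_fun_def)

lemma subspace_module_J1: "subspace_module W \<Longrightarrow> subspace_module (J1_mod W)"
  unfolding subspace_module_def J1_mod_def by (auto simp: zero_fun_def plus_fun_def)

lemma vecs_semihol_step: "vecs (semihol_step W) = {j \<in> vecs (J1_mod W). jet_proj j = jet_map jet_proj j}"
  by (simp add: semihol_step_def)

lemma subspace_module_semihol_step: "subspace_module W \<Longrightarrow> subspace_module (semihol_step W)"
  using subspace_module_J1[of W] unfolding subspace_module_def vecs_semihol_step by auto

lemma vecs_J1:
  assumes "subspace_module W" "u \<in> vecs W"
  shows "jet_val u \<in> vecs (J1_mod W)" "jet_dir s u \<in> vecs (J1_mod W)"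
proof -
  have "(\<lambda>c. jet_val u (z, c)) = (if z = None then u else (\<lambda>c. 0))"
    "(\<lambda>c. jet_dir s u (z, c)) = (if z = Some s then u else (\<lambda>c. 0))" for z
    by (auto simp: jet_val_def jet_dir_def)
  then show "jet_val u \<in> vecs (J1_mod W)" "jet_dir s u \<in> vecs (J1_mod W)"
    using assms subspace_moduleD(2)[OF assms(1)] by (auto simp: J1_mod_def)
qed

lemma subspace_module_V_mod: "subspace_module (V_mod k)"
  using V_mod_zero V_mod_lincomb[of _ k _ 1 1] by (auto simp: subspace_module_def plus_fun_def)

text \<open>Membership is built up along the tower. At each level a monomial has both projections
  zero, and the inner sums of \<open>cubic_jet\<close> have both projections equal to the same
  monomial of one order less.\<close>

lemma vecs_Jbar4:
  fixes u :: "'n::finite list \<times> 'n list \<Rightarrow> real"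
  assumes "u \<in> vecs (V_mod m)"
  shows "monomial_jet s1 s2 s3 s4 u \<in> vecs (Jbar4_mod (V_mod m))"
    and "cubic_jet s1 s2 s3 u \<in> vecs (Jbar4_mod (V_mod m))"
proof -
  define W1 where "W1 = J1_mod (V_mod m :: ('n, _) gmodule)"
  define W2 where "W2 = semihol_step W1"
  define W3 where "W3 = semihol_step W2"
  have W4: "Jbar4_mod (V_mod m) = semihol_step W3"
    by (simp add: Jbar4_mod_def W1_def W2_def W3_def)
  have s0: "subspace_module (V_mod m :: ('n, _) gmodule)" by (rule subspace_module_V_mod)
  have s1: "subspace_module W1" unfolding W1_def by (rule subspace_module_J1[OF s0])
  have s2: "subspace_module W2" unfolding W2_def by (rule subspace_module_semihol_step[OF s1])
  have s3: "subspace_module W3" unfolding W3_def by (rule subspace_module_semihol_step[OF s2])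
  have a1: "jet_dir s u \<in> vecs W1" "jet_val u \<in> vecs W1" for s
    unfolding W1_def using vecs_J1[OF s0 assms] by auto
  have a2: "jet_dir s (jet_dir t u) \<in> vecs W2" "jet_val (jet_dir s u) + jet_dir s (jet_val u) \<in> vecs W2" for s t
    using vecs_J1[OF s1 a1(1)] vecs_J1[OF s1 a1(2)] subspace_moduleD(3)[OF subspace_module_J1[OF s1]]
    unfolding W2_def vecs_semihol_step by auto
  have a3: "jet_dir r (jet_dir s (jet_dir t u)) \<in> vecs W3"
      "jet_val (jet_dir r (jet_dir s u)) + jet_dir r (jet_val (jet_dir s u) + jet_dir s (jet_val u)) \<in> vecs W3" for r s t
    using vecs_J1[OF s2 a2(1)] vecs_J1[OF s2 a2(2)] subspace_moduleD(3)[OF subspace_module_J1[OF s2]]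
    unfolding W3_def vecs_semihol_step by auto
  show "monomial_jet s1 s2 s3 s4 u \<in> vecs (Jbar4_mod (V_mod m))"
    "cubic_jet s1 s2 s3 u \<in> vecs (Jbar4_mod (V_mod m))"
    using vecs_J1[OF s3 a3(1)] vecs_J1[OF s3 a3(2)] subspace_moduleD(3)[OF subspace_module_J1[OF s3]]
    unfolding W4 vecs_semihol_step monomial_jet_def cubic_jet_def by auto
qed

section \<open>Matrix units acting on monomial and cubic jets\<close>

lemma fin_module_Jbar:
  "fin_module (J1_mod (V_mod m))" "fin_module (semihol_step (J1_mod (V_mod m)))"
  "fin_module (semihol_step (semihol_step (J1_mod (V_mod m))))"
  "fin_module (semihol_step (semihol_step (semihol_step (J1_mod (V_mod m)))))"
  by (intro fin_module_semihol_step fin_module_J1 fin_module_V_mod)+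

lemma act_Jbar4:
  "act (Jbar4_mod V) = act (J1_mod (semihol_step (semihol_step (J1_mod V))))"
  by (simp add: Jbar4_mod_def)

lemma monomial_jet_linear:
  "monomial_jet s1 s2 s3 s4 (\<lambda>c. 0) = 0" "monomial_jet s1 s2 s3 s4 0 = 0"
  "monomial_jet s1 s2 s3 s4 (\<lambda>z. r * u z) = (\<lambda>c. r * monomial_jet s1 s2 s3 s4 u c)"
  by (auto simp: monomial_jet_def jet_dir_def fun_eq_iff)

lemma act_P_monomial:
  assumes "p \<noteq> q"
  shows "act (Jbar4_mod (V_mod m)) (P_unit q p) (monomial_jet s1 s2 s3 s4 u) =
     (if fst s1 = p then monomial_jet (q, snd s1) s2 s3 s4 u else 0)
   + (if fst s2 = p then monomial_jet s1 (q, snd s2) s3 s4 u else 0)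
   + (if fst s3 = p then monomial_jet s1 s2 (q, snd s3) s4 u else 0)
   + (if fst s4 = p then monomial_jet s1 s2 s3 (q, snd s4) u else 0)"
proof -
  have 0: "act (V_mod m) (P_unit q p) u = 0" using assms by (simp add: V_mod_act_P_unit fun_eq_iff)
  show ?thesis
    unfolding act_Jbar4 monomial_jet_def
    by (simp add: act_P_jet_dir fin_module_Jbar fin_module_V_mod 0)
qed

lemma act_N_monomial:
  "act (Jbar4_mod (V_mod m)) (N_unit C a) (monomial_jet s1 s2 s3 s4 u) =
     monomial_jet s1 s2 s3 s4 (replace_index m C a u)
   + (if snd s1 = C then monomial_jet (fst s1, a) s2 s3 s4 u else 0)
   + (if snd s2 = C then monomial_jet s1 (fst s2, a) s3 s4 u else 0)
   + (if snd s3 = C then monomial_jet s1 s2 (fst s3, a) s4 u else 0)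
   + (if snd s4 = C then monomial_jet s1 s2 s3 (fst s4, a) u else 0)"
  unfolding act_Jbar4 monomial_jet_def
  by (simp add: act_N_jet_dir fin_module_Jbar fin_module_V_mod V_mod_act_N_unit)

lemma jet_dir_if: "jet_dir s (if b then X else 0) = (if b then jet_dir s X else 0)"
  by simp

text \<open>Both diagonal units act on the coefficient by the same scalar, so their difference only
  counts primed indices of the slots.\<close>

lemma act_P_diff_monomial:
  "act (Jbar4_mod (V_mod m)) (P_unit 0 0 - P_unit 1 1) (monomial_jet s1 s2 s3 s4 u) =
   (\<lambda>c. (\<Sum>s\<leftarrow>[s1, s2, s3, s4]. if fst s = 0 then 1 else -1) * monomial_jet s1 s2 s3 s4 u c)"
proof -
  have 0: "act (V_mod m) (P_unit 0 0) u = act (V_mod m) (P_unit 1 1) u"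
    by (simp add: V_mod_act_P_unit fun_eq_iff)
  have fst: "fst s = 0 \<or> fst s = 1" for s :: "'a slot" using exhaust_2[of "fst s"] by auto
  have *: "act (Jbar4_mod (V_mod m)) (P_unit p p) (monomial_jet s1 s2 s3 s4 u)
     = monomial_jet s1 s2 s3 s4 (act (V_mod m) (P_unit p p) u)
     + (if fst s1 = p then monomial_jet s1 s2 s3 s4 u else 0)
     + (if fst s2 = p then monomial_jet s1 s2 s3 s4 u else 0)
     + (if fst s3 = p then monomial_jet s1 s2 s3 s4 u else 0)
     + (if fst s4 = p then monomial_jet s1 s2 s3 s4 u else 0)" for p
    unfolding act_Jbar4 monomial_jet_def
    by (cases s1; cases s2; cases s3; cases s4)
      (auto simp add: act_P_jet_dir fin_module_Jbar fin_module_V_mod jet_dir_if add_ac)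
  have fm: "fin_module (Jbar4_mod (V_mod m) :: ('a, _) gmodule)"
    using fin_module_Jbar(4) by (simp add: Jbar4_mod_def)
  show ?thesis
    using fst[of s1] fst[of s2] fst[of s3] fst[of s4]
    unfolding act_linear(5)[OF fm] * 0
    by (elim disjE) (simp_all add: fun_eq_iff)
qed

lemma subspace_module_Jbar4: "subspace_module (Jbar4_mod (V_mod m))"
  unfolding Jbar4_mod_def
  by (intro subspace_module_semihol_step subspace_module_J1 subspace_module_V_mod)

text \<open>By \<open>act_Z_jet_val\<close> a new slot is inserted at one of four positions, and the
  grade-zero part of the bracket acts on everything to its right. Acting on a slot it yields the 6 +
  4 + 2 monomials of the first group; acting on \<open>u\<close> it yields the last four
  groups.\<close>

lemma act_Z_cubic:
  "act (Jbar4_mod (V_mod m)) (Z_unit z a) (cubic_jet s1 s2 s3 u) =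
     (monomial_jet (fst s1, a) (z, snd s1) s2 s3 u + monomial_jet (z, snd s1) (fst s1, a) s2 s3 u
    + monomial_jet (fst s2, a) s1 (z, snd s2) s3 u + monomial_jet (z, snd s2) s1 (fst s2, a) s3 u
    + monomial_jet (fst s3, a) s1 s2 (z, snd s3) u + monomial_jet (z, snd s3) s1 s2 (fst s3, a) u
    + monomial_jet s1 (fst s2, a) (z, snd s2) s3 u + monomial_jet s1 (z, snd s2) (fst s2, a) s3 u
    + monomial_jet s1 (fst s3, a) s2 (z, snd s3) u + monomial_jet s1 (z, snd s3) s2 (fst s3, a) u
    + monomial_jet s1 s2 (fst s3, a) (z, snd s3) u + monomial_jet s1 s2 (z, snd s3) (fst s3, a) u)
   + (monomial_jet (z, a) s1 s2 s3 (\<lambda>c. real m * u c)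
      + (\<Sum>C\<in>UNIV. monomial_jet (z, C) s1 s2 s3 (replace_index m C a u)))
   + (monomial_jet s1 (z, a) s2 s3 (\<lambda>c. real m * u c)
      + (\<Sum>C\<in>UNIV. monomial_jet s1 (z, C) s2 s3 (replace_index m C a u)))
   + (monomial_jet s1 s2 (z, a) s3 (\<lambda>c. real m * u c)
      + (\<Sum>C\<in>UNIV. monomial_jet s1 s2 (z, C) s3 (replace_index m C a u)))
   + (monomial_jet s1 s2 s3 (z, a) (\<lambda>c. real m * u c)
      + (\<Sum>C\<in>UNIV. monomial_jet s1 s2 s3 (z, C) (replace_index m C a u)))"
proof -
  have P: "act (V_mod m) (P_unit z p) u = (if z = p then (\<lambda>c. real m * u c) else 0)" for p
    by (auto simp: V_mod_act_P_unit fun_eq_iff)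
  show ?thesis
    unfolding act_Jbar4 cubic_jet_def monomial_jet_def
    by (simp add: act_linear(1-6) fin_module_Jbar fin_module_V_mod fin_module_J1 act_Z_jet_val act_Z_jet_dir
        act_P_jet_dir act_N_jet_dir V_mod_act_Z_unit V_mod_act_N_unit P jet_dir_if jet_dir_sum sum.distrib)
qed

text \<open>Writing \<open>C\<close> over \<open>a\<close> in one copy of \<open>T\<close> repeats
  \<open>C\<close> within a column, where \<open>v\<close> vanishes by alternation. So the
  \<open>(T, T)\<close> component is insensitive to these replacements.\<close>

lemma replace_index_top_off_diagonal:
  assumes "v \<in> vecs (V_mod k)" "distinct T" "length T = k" "a \<noteq> C" "C \<in> set T"
  shows "replace_index k C a v (T, T) = 0"
proof -
  have "\<not> distinct (T[i := C])" if "i < k" "T ! i = a" for i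
  proof -
    obtain j where "j < k" "T ! j = C" using assms by (auto simp: in_set_conv_nth)
    with that assms have ij: "i \<noteq> j" by auto
    with that \<open>j < k\<close> \<open>T ! j = C\<close> assms(3) have "i < length (T[i := C])" "j < length (T[i := C])"
      "T[i := C] ! i = T[i := C] ! j" by simp_all
    with ij show ?thesis unfolding distinct_conv_nth by blast
  qed
  then have "v (T[i := C], T) = 0 \<and> v (T, T[i := C]) = 0" if "i < k" "T ! i = a" for i
    using V_mod_repeated[OF assms(1)] that by blast
  then show ?thesis
    unfolding replace_index_def split_conv by (subst (1 2) sum.neutral) auto
qed

text \<open>An index of \<open>T\<close> occurs exactly once in each of the two columns.\<close>

lemma replace_index_top_diagonal:
  assumes "distinct T" "length T = k"
  shows "replace_index k C C v (T, T) = 2 * of_bool (C \<in> set T) * v (T, T)"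
proof -
  have up: "T ! i = C \<Longrightarrow> T[i := C] = T" for i by auto
  have "replace_index k C C v (T, T)
      = (\<Sum>i<k. if T ! i = C then v (T, T) else 0) + (\<Sum>i<k. if T ! i = C then v (T, T) else 0)"
    unfolding replace_index_def split_conv
    by (intro arg_cong2[where f = "(+)"] sum.cong refl) (simp_all add: up)
  then show ?thesis
    using sum_count_mset[of T C "v (T, T)"] assms(1)[unfolded distinct_count_atmost_1] assms(2)
    by simp
qed

subsection \<open>Consequences of equivariance\<close>

text \<open>Only equivariance is recorded here; that \<open>\<Psi>\<close> agrees with the given
  homomorphism on holonomic jets enters in the final theorem.\<close>

locale strong_extension =
  fixes m k :: nat and T :: "'n::finite list"
    and \<Psi> :: "(('n, 'n list \<times> 'n list) jc4 \<Rightarrow> real) \<Rightarrow> 'n list \<times> 'n list \<Rightarrow> real"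
  assumes hom: "gmodule_hom p_alg (Jbar4_mod (V_mod m)) (V_mod k) \<Psi>"
    and T: "distinct T" "length T = k" and k: "k = m + 2"
begin

definition top :: "(('n, 'n list \<times> 'n list) jc4 \<Rightarrow> real) \<Rightarrow> real" where
  "top j = \<Psi> j (T, T)"

abbreviation "J4 \<equiv> Jbar4_mod (V_mod m) :: ('n, _) gmodule"

lemma top_lincomb:
  assumes "f \<in> vecs J4" "g \<in> vecs J4"
  shows "top (\<lambda>c. a * f c + b * g c) = a * top f + b * top g"
  using hom assms by (simp add: gmodule_hom_def top_def)

lemma zero_J4: "0 \<in> vecs J4" and add_J4: "f \<in> vecs J4 \<Longrightarrow> g \<in> vecs J4 \<Longrightarrow> f + g \<in> vecs J4"
  using subspace_module_Jbar4 by (auto simp: subspace_module_def)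

lemma top_add: "f \<in> vecs J4 \<Longrightarrow> g \<in> vecs J4 \<Longrightarrow> top (f + g) = top f + top g"
  using top_lincomb[of f g 1 1] by (simp add: plus_fun_def)

lemma top_scale: "f \<in> vecs J4 \<Longrightarrow> top (\<lambda>c. a * f c) = a * top f"
  using top_lincomb[of f f a 0] by simp

lemma top_zero: "top 0 = 0"
  using top_scale[OF zero_J4, of 0] by (simp add: zero_fun_def)

lemma sum_J4: "(\<And>i. i \<in> I \<Longrightarrow> f i \<in> vecs J4) \<Longrightarrow> (\<Sum>i\<in>I. f i) \<in> vecs J4"
proof (induction I rule: infinite_finite_induct)
  case (insert i I)
  then show ?case unfolding sum.insert[OF insert.hyps] by (intro add_J4) auto
qed (simp_all only: sum.infinite sum.empty zero_J4 not_False_eq_True)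

lemma top_sum: "(\<And>i. i \<in> I \<Longrightarrow> f i \<in> vecs J4) \<Longrightarrow> top (\<Sum>i\<in>I. f i) = (\<Sum>i\<in>I. top (f i))"
proof (induction I rule: infinite_finite_induct)
  case (insert i I)
  then show ?case
    unfolding sum.insert[OF insert.hyps]
    by (subst top_add) (auto intro: sum_J4)
qed (simp_all only: sum.infinite sum.empty top_zero not_False_eq_True)

lemma top_if: "top (if b then X else 0) = (if b then top X else 0)"
  by (simp add: top_zero)

lemma top_act:
  assumes "f \<in> vecs J4" "M \<in> p_alg"
  shows "top (act J4 M f) = act (V_mod k) M (\<Psi> f) (T, T)"
  using hom assms by (simp add: gmodule_hom_def top_def)

lemma \<Psi>_V_mod: "f \<in> vecs J4 \<Longrightarrow> \<Psi> f \<in> vecs (V_mod k)"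
  using hom by (simp add: gmodule_hom_def)

lemma top_act_P: "f \<in> vecs J4 \<Longrightarrow> p \<noteq> q \<Longrightarrow> top (act J4 (P_unit q p) f) = 0"
  by (simp add: top_act matrix_unit_in_p_alg V_mod_act_P_unit)

lemma top_act_Z: "f \<in> vecs J4 \<Longrightarrow> top (act J4 (Z_unit z a) f) = 0"
  by (simp add: top_act matrix_unit_in_p_alg V_mod_act_Z_unit)

text \<open>On the target side this is \<open>replace_index_top_off_diagonal\<close>; the index
  \<open>a\<close> may be any index other than \<open>C\<close>, inside or outside
  \<open>T\<close>.\<close>

lemma top_act_N:
  assumes "f \<in> vecs J4" "a \<noteq> C" "C \<in> set T"
  shows "top (act J4 (N_unit C a) f) = 0"
  using assms T \<Psi>_V_mod
  by (simp add: top_act matrix_unit_in_p_alg V_mod_act_N_unit replace_index_top_off_diagonal)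

text \<open>The trace-free diagonal element of gl(2) kills the target and multiplies the monomial by
  its weight, so a nonzero weight forces the value to vanish.\<close>

lemma top_monomial_weight:
  assumes "u \<in> vecs (V_mod m)" "(\<Sum>s\<leftarrow>[s1, s2, s3, s4]. if fst s = 0 then 1 else -1 :: real) \<noteq> 0"
  shows "top (monomial_jet s1 s2 s3 s4 u) = 0"
proof -
  have "P_unit 0 0 - P_unit 1 1 \<in> (p_alg :: 'n gmat set)"
    by (auto simp: p_alg_def trace_def matrix_unit_apply sum_subtractf of_bool_conj)
  moreover have "act (V_mod k) (P_unit 0 0 - P_unit 1 1) v = 0" for v :: "'n list \<times> 'n list \<Rightarrow> real"
    unfolding act_linear(5)[OF fin_module_V_mod] by (simp add: V_mod_act_P_unit)
  ultimately have "top (act J4 (P_unit 0 0 - P_unit 1 1) (monomial_jet s1 s2 s3 s4 u)) = 0"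
    by (simp add: top_act vecs_Jbar4 assms(1))
  then show ?thesis
    unfolding act_P_diff_monomial top_scale[OF vecs_Jbar4(1)[OF assms(1)]] using assms(2) by auto
qed

text \<open>The condition \<open>absent\<close> expresses that \<open>u\<close> contains no index
  outside \<open>drop 2 T\<close>: there is nothing to be replaced.\<close>

context
  fixes u assumes u: "u \<in> vecs (V_mod m)"
    and absent: "\<And>C a. C \<notin> set (drop 2 T) \<Longrightarrow> replace_index m C a u = 0"
begin

abbreviation w where "w s1 s2 s3 s4 \<equiv> top (monomial_jet s1 s2 s3 s4 u)"

lemma relation_P:
  assumes "p \<noteq> q"
  shows "(if fst s1 = p then w (q, snd s1) s2 s3 s4 else 0) + (if fst s2 = p then w s1 (q, snd s2) s3 s4 else 0)
   + (if fst s3 = p then w s1 s2 (q, snd s3) s4 else 0) + (if fst s4 = p then w s1 s2 s3 (q, snd s4) else 0) = 0"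
proof -
  note v = vecs_Jbar4(1)[OF u]
  have if_J4: "f \<in> vecs J4 \<Longrightarrow> (if b then f else 0) \<in> vecs J4" for f b by (simp add: zero_J4)
  show ?thesis
    using top_act_P[OF v assms, of s1 s2 s3 s4]
    unfolding act_P_monomial[OF assms]
    by (simp only: top_add add_J4 if_J4 v top_if)
qed

text \<open>The term acting on the coefficient is kept: it vanishes for \<open>C\<close> outside
  \<open>drop 2 T\<close>, and for \<open>C\<close> inside it is traded for a change of slots in
  \<open>relation_Z\<close>.\<close>

lemma relation_N:
  assumes "C \<in> set T" "a \<noteq> C"
  shows "top (monomial_jet s1 s2 s3 s4 (replace_index m C a u))
   + (if snd s1 = C then w (fst s1, a) s2 s3 s4 else 0) + (if snd s2 = C then w s1 (fst s2, a) s3 s4 else 0)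
   + (if snd s3 = C then w s1 s2 (fst s3, a) s4 else 0) + (if snd s4 = C then w s1 s2 s3 (fst s4, a) else 0) = 0"
proof -
  note v = vecs_Jbar4(1)[OF u] vecs_Jbar4(1)[OF V_mod_replace_index[OF u]]
  have if_J4: "f \<in> vecs J4 \<Longrightarrow> (if b then f else 0) \<in> vecs J4" for f b by (simp add: zero_J4)
  show ?thesis
    using top_act_N[OF v(1) assms(2,1), of s1 s2 s3 s4]
    unfolding act_N_monomial
    by (simp only: top_add add_J4 if_J4 v top_if)
qed

text \<open>
  Inserting \<open>(z, a)\<close> contributes \<open>m\<close> times a monomial, while the \<open>m\<close> indices \<open>C\<close> of \<open>drop 2 T\<close>, on which
  \<open>N_unit C a\<close> may be moved from \<open>u\<close> to the inserted slot, contribute minus the same monomial each.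
\<close>

lemma relation_Z:
  assumes "a \<notin> set (drop 2 T)" "snd s1 \<notin> set (drop 2 T)" "snd s2 \<notin> set (drop 2 T)" "snd s3 \<notin> set (drop 2 T)"
  shows "w (fst s1, a) (z, snd s1) s2 s3 + w (z, snd s1) (fst s1, a) s2 s3
    + w (fst s2, a) s1 (z, snd s2) s3 + w (z, snd s2) s1 (fst s2, a) s3
    + w (fst s3, a) s1 s2 (z, snd s3) + w (z, snd s3) s1 s2 (fst s3, a)
    + w s1 (fst s2, a) (z, snd s2) s3 + w s1 (z, snd s2) (fst s2, a) s3
    + w s1 (fst s3, a) s2 (z, snd s3) + w s1 (z, snd s3) s2 (fst s3, a)
    + w s1 s2 (fst s3, a) (z, snd s3) + w s1 s2 (z, snd s3) (fst s3, a) = 0"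
proof -
  note v = vecs_Jbar4(1)[OF u] vecs_Jbar4(1)[OF V_mod_replace_index[OF u]]
  have mu: "(\<lambda>c. real m * u c) \<in> vecs (V_mod m)" using V_mod_lincomb[OF u u, of "real m" 0] by simp
  note v' = vecs_Jbar4(1)[OF mu]
  have ms: "top (monomial_jet t1 t2 t3 t4 (\<lambda>c. real m * u c)) = real m * w t1 t2 t3 t4" for t1 t2 t3 t4
    unfolding monomial_jet_linear(3) by (rule top_scale[OF v(1)])
  let ?I = "set (drop 2 T)"
  have IT: "?I \<subseteq> set T" by (rule set_drop_subset)
  have card: "card ?I = m" using T k by (simp add: distinct_card)
  have cancel: "real m * x + (\<Sum>C\<in>UNIV. f C) = 0"
    if "\<And>C. C \<notin> ?I \<Longrightarrow> f C = 0" "\<And>C. C \<in> ?I \<Longrightarrow> f C = - x" for f :: "'n \<Rightarrow> real" and x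
  proof -
    have "(\<Sum>C\<in>UNIV. f C) = (\<Sum>C\<in>?I. f C)" by (rule sum.mono_neutral_right) (auto simp: that)
    also have "\<dots> = - (real m * x)" using card by (simp add: that)
    finally show ?thesis by simp
  qed
  have absent0: "top (monomial_jet t1 t2 t3 t4 (replace_index m C a u)) = 0" if "C \<notin> ?I" for C t1 t2 t3 t4
    using absent[OF that] by (simp only: monomial_jet_linear(2) top_zero)
  \<comment> \<open>As \<open>a\<close> and the given slots avoid \<open>drop 2 T\<close>, a
    replacement of such a \<open>C\<close> meets only the coefficient and the inserted slot.\<close>
  have aC: "C \<in> ?I \<Longrightarrow> a \<noteq> C" "C \<in> ?I \<Longrightarrow> C \<in> set T" "C \<in> ?I \<Longrightarrow> snd s1 \<noteq> C \<and> snd s2 \<noteq> C \<and> snd s3 \<noteq> C" for C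
    using assms IT by auto
  \<comment> \<open>One cancellation for each position of the inserted slot.\<close>
  have c1: "real m * w (z, a) s1 s2 s3 + (\<Sum>C\<in>UNIV. top (monomial_jet (z, C) s1 s2 s3 (replace_index m C a u))) = 0"
  proof (rule cancel[OF absent0])
    fix C assume C: "C \<in> ?I"
    show "top (monomial_jet (z, C) s1 s2 s3 (replace_index m C a u)) = - w (z, a) s1 s2 s3"
      using relation_N[OF aC(2)[OF C] aC(1)[OF C], of "(z, C)" s1 s2 s3] aC(3)[OF C] by simp
  qed
  have c2: "real m * w s1 (z, a) s2 s3 + (\<Sum>C\<in>UNIV. top (monomial_jet s1 (z, C) s2 s3 (replace_index m C a u))) = 0"
  proof (rule cancel[OF absent0])
    fix C assume C: "C \<in> ?I"
    show "top (monomial_jet s1 (z, C) s2 s3 (replace_index m C a u)) = - w s1 (z, a) s2 s3"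
      using relation_N[OF aC(2)[OF C] aC(1)[OF C], of s1 "(z, C)" s2 s3] aC(3)[OF C] by simp
  qed
  have c3: "real m * w s1 s2 (z, a) s3 + (\<Sum>C\<in>UNIV. top (monomial_jet s1 s2 (z, C) s3 (replace_index m C a u))) = 0"
  proof (rule cancel[OF absent0])
    fix C assume C: "C \<in> ?I"
    show "top (monomial_jet s1 s2 (z, C) s3 (replace_index m C a u)) = - w s1 s2 (z, a) s3"
      using relation_N[OF aC(2)[OF C] aC(1)[OF C], of s1 s2 "(z, C)" s3] aC(3)[OF C] by simp
  qed
  have c4: "real m * w s1 s2 s3 (z, a) + (\<Sum>C\<in>UNIV. top (monomial_jet s1 s2 s3 (z, C) (replace_index m C a u))) = 0"
  proof (rule cancel[OF absent0])
    fix C assume C: "C \<in> ?I"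
    show "top (monomial_jet s1 s2 s3 (z, C) (replace_index m C a u)) = - w s1 s2 s3 (z, a)"
      using relation_N[OF aC(2)[OF C] aC(1)[OF C], of s1 s2 s3 "(z, C)"] aC(3)[OF C] by simp
  qed
  note E = top_act_Z[OF vecs_Jbar4(2)[OF u], of z a s1 s2 s3, unfolded act_Z_cubic]
  show ?thesis
    using E c1 c2 c3 c4
    by (simp only: top_add add_J4 v v' sum_J4 top_sum ms)
qed

text \<open>Changing one 0 into 1 in the four arrangements with a single 1 gives four equations.
  They leave three unknowns with sum zero, matching the two-dimensional space of sl(2)-invariants in
  the fourth tensor power.\<close>

lemma balanced_P:
  fixes b1 b2 b3 b4 :: 'n
  defines "x \<equiv> \<lambda>y1 y2 y3 y4. w (y1, b1) (y2, b2) (y3, b3) (y4, b4)"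
  shows "x 1 1 0 0 = x 0 0 1 1" "x 1 0 1 0 = x 0 1 0 1" "x 1 0 0 1 = x 0 1 1 0"
    "x 0 0 1 1 + x 0 1 0 1 + x 0 1 1 0 = 0"
proof -
  note R = relation_P[of 0 1 "(_, b1)" "(_, b2)" "(_, b3)" "(_, b4)", folded x_def]
  have "x 1 0 0 1 + x 0 1 0 1 + x 0 0 1 1 = 0" "x 1 0 1 0 + x 0 1 1 0 + x 0 0 1 1 = 0"
    "x 1 1 0 0 + x 0 1 1 0 + x 0 1 0 1 = 0" "x 1 1 0 0 + x 1 0 1 0 + x 1 0 0 1 = 0"
    using R[of 0 0 0 1] R[of 0 0 1 0] R[of 0 1 0 0] R[of 1 0 0 0] by (simp_all add: x_def)
  then show "x 1 1 0 0 = x 0 0 1 1" "x 1 0 1 0 = x 0 1 0 1" "x 1 0 0 1 = x 0 1 1 0"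
    "x 0 0 1 1 + x 0 1 0 1 + x 0 1 1 0 = 0" by linarith+
qed

text \<open>The same elimination for the second sl(2), acting on the indices \<open>c\<close> and
  \<open>d\<close>. The coefficient does not interfere because it contains no
  \<open>c\<close>.\<close>

lemma balanced_N:
  fixes y1 y2 y3 y4 :: 2
  defines "c \<equiv> T ! 0" and "d \<equiv> T ! 1"
  defines "x \<equiv> \<lambda>b1 b2 b3 b4. w (y1, b1) (y2, b2) (y3, b3) (y4, b4)"
  shows "x d d c c = x c c d d" "x d c d c = x c d c d" "x d c c d = x c d d c"
    "x c c d d + x c d c d + x c d d c = 0"
proof -
  have cd: "c \<in> set T" "d \<noteq> c" "c \<notin> set (drop 2 T)"
    using T k by (auto simp: c_def d_def nth_eq_iff_index_eq in_set_conv_nth)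
  have 0: "top (monomial_jet s1 s2 s3 s4 (replace_index m c d u)) = 0" for s1 s2 s3 s4
    using absent[OF cd(3)] by (simp only: monomial_jet_linear(2) top_zero)
  note R = relation_N[OF cd(1,2), of "(y1, _)" "(y2, _)" "(y3, _)" "(y4, _)", unfolded 0]
  have "x d c c d + x c d c d + x c c d d = 0" "x d c d c + x c d d c + x c c d d = 0"
    "x d d c c + x c d d c + x c d c d = 0" "x d d c c + x d c d c + x d c c d = 0"
    using R[of c c c d] R[of c c d c] R[of c d c c] R[of d c c c] cd(2) by (simp_all add: x_def)
  then show "x d d c c = x c c d d" "x d c d c = x c d c d" "x d c c d = x c d d c"
    "x c c d d + x c d c d + x c d d c = 0" by linarith+
qed

text \<open>This is the value on the fourth power of the linear form with slots in \<open>E\<close>.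
  Weight leaves six of its sixteen terms, and their sum is a linear consequence of one
  \<open>relation_Z\<close> and the invariance under both copies of sl(2).\<close>

lemma top_determinant_square:
  defines "E \<equiv> {(0, T ! 0), (1, T ! 1)}"
  shows "(\<Sum>s1\<in>E. \<Sum>s2\<in>E. \<Sum>s3\<in>E. \<Sum>s4\<in>E. w s1 s2 s3 s4) = 0"
proof -
  define c d where "c = T ! 0" and "d = T ! 1"
  have cd: "d \<noteq> c" "c \<notin> set (drop 2 T)" "d \<notin> set (drop 2 T)"
    using T k by (auto simp: c_def d_def nth_eq_iff_index_eq in_set_conv_nth)
  note N = balanced_N[folded c_def d_def]
  \<comment> \<open>\<open>Z_unit 0 c\<close> is applied to the cubic jet with slots
    \<open>(0, d)\<close>, \<open>(1, c)\<close>, \<open>(1, d)\<close>. This choice makes each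
    resulting term contain 0, 1, \<open>c\<close> and \<open>d\<close> exactly twice.\<close>
  have Z: "2 * w (0, c) (0, d) (1, c) (1, d) + 2 * w (0, d) (0, c) (1, c) (1, d)
      + w (1, c) (0, d) (0, c) (1, d) + w (1, c) (0, d) (1, c) (0, d)
      + 2 * w (0, d) (0, d) (1, c) (1, c) + w (0, d) (1, c) (0, c) (1, d)
      + 2 * w (0, d) (1, c) (1, c) (0, d) + w (0, d) (1, c) (0, d) (1, c) = 0"
    using relation_Z[OF cd(2), of "(0, d)" "(1, c)" "(1, d)" 0] cd(2,3) by simp
  \<comment> \<open>\<open>P\<close> runs through all six arrangements of two \<open>c\<close> and
    two \<open>d\<close>; for \<open>N\<close> the four arrangements chosen suffice to finish by
    linear arithmetic.\<close>
  note P = balanced_P[of c c d d] balanced_P[of c d c d] balanced_P[of c d d c]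
    balanced_P[of d d c c] balanced_P[of d c d c] balanced_P[of d c c d]
  note N = N[of 0 0 1 1] N[of 0 1 0 1] N[of 0 1 1 0] N[of 1 0 0 1]
  note weight = top_monomial_weight[OF u]
  have "w (0, c) (0, c) (1, d) (1, d) + w (0, c) (1, d) (0, c) (1, d) + w (0, c) (1, d) (1, d) (0, c)
      + w (1, d) (0, c) (0, c) (1, d) + w (1, d) (0, c) (1, d) (0, c) + w (1, d) (1, d) (0, c) (0, c) = 0"
    using Z P N by linarith
  then show ?thesis
    unfolding E_def c_def[symmetric] d_def[symmetric]
    by (simp add: weight add_ac)
qed

end

end

subsection \<open>The fourth power of a linear form\<close>

lemma zero_or_one: "p = 0 \<or> p = (1 :: 2)"
  using exhaust_2[of p] by auto

lemma sum_UNIV_2_zero_one: "sum f (UNIV :: 2 set) = f 0 + f 1"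
proof -
  have "(UNIV :: 2 set) = {0, 1}" using zero_or_one by auto
  show ?thesis unfolding \<open>UNIV = {0, 1}\<close> by simp
qed

lemma power_has_derivative:
  fixes l :: "'n::finite gminus \<Rightarrow> real"
  assumes "linear l"
  shows "((\<lambda>y. a * l y ^ n) has_derivative (\<lambda>h. a * (real n * l h) * l x ^ (n - 1))) (at x)"
proof -
  have "bounded_linear l" using assms by (simp add: linear_linear)
  then show ?thesis
    by (auto intro!: derivative_eq_intros bounded_linear_imp_has_derivative)
qed

lemma partial_deriv_power:
  assumes "linear l"
  shows "partial_deriv s (\<lambda>y. a * l y ^ n) = (\<lambda>x. a * (real n * l (gm_basis s)) * l x ^ (n - 1))"
  using frechet_derivative_at[OF power_has_derivative[OF assms, of a n], symmetric]
  by (simp add: partial_deriv_def fun_eq_iff)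

lemma smooth_fun_power:
  assumes "linear l"
  shows "smooth_fun (\<lambda>y. a * l y ^ n)"
  unfolding smooth_fun_def
proof (intro allI)
  fix ss x
  show "fold partial_deriv ss (\<lambda>y. a * l y ^ n) differentiable at x"
  proof (induction ss arbitrary: a n)
    case Nil
    show ?case unfolding fold_simps by (rule differentiableI[OF power_has_derivative[OF assms]])
  next
    case (Cons s ss)
    from Cons[of "a * (real n * l (gm_basis s))" "n - 1"] show ?case
      by (simp add: partial_deriv_power[OF assms])
  qed
qed

text \<open>Every coordinate of an iterated 1-jet of a power of \<open>l\<close> is a constant times
  a power of \<open>l\<close>. The constant and the exponent are tracked coordinatewise, so that
  \<open>jet1\<close> can be iterated; at exponent 0 the truncated subtraction is harmless since the
  constant becomes 0.\<close>

definition power_coeff ::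
  "('n::finite gminus \<Rightarrow> real) \<Rightarrow> ('c \<Rightarrow> real) \<Rightarrow> ('c \<Rightarrow> nat) \<Rightarrow> ('n, 'c) jc \<Rightarrow> real" where
  "power_coeff l a n = (\<lambda>(z, c). case z of None \<Rightarrow> a c | Some s \<Rightarrow> a c * (real (n c) * l (gm_basis s)))"

definition power_degree :: "('c \<Rightarrow> nat) \<Rightarrow> ('n, 'c) jc \<Rightarrow> nat" where
  "power_degree n = (\<lambda>(z, c). case z of None \<Rightarrow> n c | Some s \<Rightarrow> n c - 1)"

lemma jet1_power:
  assumes "linear l"
  shows "jet1 (\<lambda>x c. a c * l x ^ n c) = (\<lambda>x c. power_coeff l a n c * l x ^ power_degree n c)"
  by (auto simp: jet1_def power_coeff_def power_degree_def partial_deriv_power[OF assms] fun_eq_iff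
      split: option.splits)

definition jet_lin :: "('n::finite gminus \<Rightarrow> real) \<Rightarrow> ('c \<Rightarrow> real) \<Rightarrow> ('n, 'c) jc \<Rightarrow> real" where
  "jet_lin l j = (\<lambda>(z, c). case z of None \<Rightarrow> 0 | Some s \<Rightarrow> l (gm_basis s) * j c)"

text \<open>A coordinate with fewer than four derivatives retains a positive power of
  \<open>l\<close>, which vanishes at the origin. Four derivatives of the fourth power give the
  factor 24.\<close>

lemma jet1_quartic:
  fixes u :: "'c \<Rightarrow> real"
  assumes "linear l"
  shows "jet1 (jet1 (jet1 (jet1 (\<lambda>x c. u c * l x ^ 4)))) 0
     = (\<lambda>c. 24 * jet_lin l (jet_lin l (jet_lin l (jet_lin l u))) c)"
proof -
  have "jet1 (jet1 (jet1 (jet1 (\<lambda>x c. u c * l x ^ 4)))) 0 (z1, z2, z3, z4, c)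
      = 24 * jet_lin l (jet_lin l (jet_lin l (jet_lin l u))) (z1, z2, z3, z4, c)" for z1 z2 z3 z4 c
    unfolding jet1_power[OF assms, of u "\<lambda>_. 4"] jet1_power[OF assms]
    by (cases z1; cases z2; cases z3; cases z4)
      (simp_all add: jet_lin_def power_coeff_def power_degree_def linear_0[OF assms])
  then show ?thesis by auto
qed

lemma jet_lin_two_slots:
  "jet_lin (\<lambda>x. slot_coord e x + slot_coord e' x) j = jet_dir e j + jet_dir e' j"
  by (rule jet_eqI) (auto simp: jet_lin_def slot_coord_gm_basis)

section \<open>Explicit symmetrizers on two and four indices\<close>

lemma permutes_lessThan_2: "{p. p permutes {..<2 :: nat}} = {id, Transposition.transpose 0 1}"
proof -
  have "{..<2 :: nat} = {0, 1}" by auto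
  then show ?thesis by (auto simp: permutes_doubleton_iff)
qed

lemma young_symmetrizer_2:
  "young_symmetrizer 2 t ([a, b], [c, d]) =
     (let f = \<lambda>a b c d. t ([a, b], [c, d]) + t ([c, b], [a, d]) + t ([a, d], [c, b]) + t ([c, d], [a, b])
      in f a b c d - f b a c d - f a b d c + f b a d c)"
proof -
  have ne: "id \<noteq> Transposition.transpose 0 (1 :: nat)"
    by (metis id_apply transpose_apply_first zero_neq_one)
  have Pow: "Pow {..<2 :: nat} = {{}, {0}, {1}, {0, 1}}"
  proof -
    have "{..<2 :: nat} = {0, 1}" by auto
    then show ?thesis by (simp add: Pow_insert insert_commute)
  qed
  have sgn: "sign (Transposition.transpose 0 (1 :: nat)) = -1" by (simp add: sign_swap_id)
  have p: "permute_list (Transposition.transpose 0 1) [x, y] = [y, x]" for x y :: 'a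
    by (simp add: permute_list_def)
  have r: "row_swap 2 S ([x, y], [z, w]) =
      ([if 0 \<in> S then z else x, if 1 \<in> S then w else y], [if 0 \<in> S then x else z, if 1 \<in> S then y else w])"
    for S and x y z w :: 'a
    by (simp add: row_swap_def upt_rec)
  have rows: "(\<Sum>S\<in>Pow {..<2}. t (row_swap 2 S ([x, y], [z, w]))) =
      t ([x, y], [z, w]) + t ([z, y], [x, w]) + t ([x, w], [z, y]) + t ([z, w], [x, y])" for x y z w
    unfolding Pow r by simp
  show ?thesis
    unfolding young_symmetrizer_def permutes_lessThan_2
    using ne by (simp add: sgn p rows Let_def del: One_nat_def)
qed

lemma alt_four_eq:
  "24 * alt_four T A B C D =
     T A B C D - T A B D C - T A C B D + T A C D B + T A D B C - T A D C B
     - T B A C D + T B A D C + T B C A D - T B C D A - T B D A C + T B D C A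
     + T C A B D - T C A D B - T C B A D + T C B D A + T C D A B - T C D B A
     - T D A B C + T D A C B + T D B A C - T D B C A - T D C A B + T D C B A"
proof -
  \<comment> \<open>Nested insertions let the sum over permutations be unfolded one element at a
    time, with the sign read off from the transpositions.\<close>
  have S: "{..<4 :: nat} = insert 0 (insert 1 (insert 2 {3}))" by auto
  have id: "{p. p permutes {3 :: nat}} = {id}" by auto
  have sg: "sign (Transposition.transpose a b \<circ> p) = (if a = b then 1 else -1) * sign p"
    if "permutation p" for a b :: nat and p
    using that by (simp add: sign_compose permutation_swap_id sign_swap_id)
  have pm: "permutation (Transposition.transpose a b \<circ> p)" if "permutation p" for a b :: nat and p
    using that by (simp add: permutation_compose permutation_swap_id)
  have l: "[A, B, C, D] ! 0 = A" "[A, B, C, D] ! 1 = B" "[A, B, C, D] ! 2 = C" "[A, B, C, D] ! 3 = D" by auto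
  have pl: "permute_list p [A, B, C, D] ! i = [A, B, C, D] ! p i" if "i < 4" for p i
  proof -
    have "i = 0 \<or> i = 1 \<or> i = 2 \<or> i = 3" using that by auto
    then show ?thesis by (elim disjE) (simp_all add: permute_list_def upt_rec numeral_2_eq_2 numeral_3_eq_3)
  qed
  have "24 * alt_four T A B C D = (\<Sum>p | p permutes insert 0 (insert 1 (insert 2 {3 :: nat})).
      of_int (sign p) * (let xs = permute_list p [A, B, C, D] in T (xs ! 0) (xs ! 1) (xs ! 2) (xs ! 3)))"
    unfolding S[symmetric] by (simp add: alt_four_def)
  also have "\<dots> = T A B C D - T A B D C - T A C B D + T A C D B + T A D B C - T A D C B
     - T B A C D + T B A D C + T B C A D - T B C D A - T B D A C + T B D C A
     + T C A B D - T C A D B - T C B A D + T C B D A + T C D A B - T C D B A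
     - T D A B C + T D A C B + T D B A C - T D B C A - T D C A B + T D C B A"
    by (simp add: Let_def sum_over_permutations_insert id sg pm sign_swap_id permutation_swap_id
        transpose_def pl del: One_nat_def)
  finally show ?thesis .
qed

text \<open>The alternation is the Pluecker relation \<open>F \<and> F = 0\<close> of the simple bivector \<open>F = x \<and> y\<close>.\<close>

lemma alt_four_simple_square:
  assumes "\<And>A B. F A B = x A * y B - x B * y A"
  shows "alt_four (\<lambda>A B C D. r * F A B * F C D) A B C D = 0"
proof -
  have "24 * alt_four (\<lambda>A B C D. r * F A B * F C D) A B C D = 0"
    unfolding alt_four_eq assms by (simp add: algebra_simps)
  then show ?thesis by simp
qed

text \<open>Each of the two contractions turns a pair of factors \<open>l\<close> into the bivector
  \<open>F\<close> up to sign, and the signs cancel. The pair alternations fix the square of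
  \<open>F\<close>, the full alternation kills it, and the symmetrized basis tensor is 4 times this
  square, whence 6 = 24 / 4.\<close>

lemma phi_map_quartic:
  fixes u :: "'c \<Rightarrow> real" and c d :: "'n::finite"
  defines "l \<equiv> \<lambda>x. slot_coord (0, c) x + slot_coord (1, d) x"
  shows "phi_map (top_proj (\<lambda>j. 24 * jet_lin l (jet_lin l (jet_lin l (jet_lin l u))) j))
    = (\<lambda>(z, e). 6 * young_symmetrizer 2 (unit_tensor ([c, d], [c, d])) z * u e)"
proof -
  let ?w = "top_proj (\<lambda>j. 24 * jet_lin l (jet_lin l (jet_lin l (jet_lin l u))) j)"
  define x y :: "'n \<Rightarrow> real" where "x = (\<lambda>A. of_bool (A = c))" and "y = (\<lambda>A. of_bool (A = d))"
  define F where "F A B = x A * y B - x B * y A" for A B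
  have l: "l (gm_basis (0, A)) = x A" "l (gm_basis (1, A)) = y A" for A
    by (auto simp: l_def slot_coord_gm_basis x_def y_def)
  have contract: "phi_contract ?w e = (\<lambda>A B C D. 24 * u e * F A B * F C D)" for e
    by (simp add: fun_eq_iff phi_contract_def sum_UNIV_2_zero_one eps_lower_def top_proj_def jet_lin_def l F_def
        algebra_simps)
  have Y: "young_symmetrizer 2 (unit_tensor ([c, d], [c, d])) ([A, B], [C, D]) = 4 * F A B * F C D" for A B C D
  proof -
    have t: "unit_tensor ([c, d], [c, d]) ([A, B], [C, D]) = x A * y B * x C * y D" for A B C D
      by (simp add: unit_tensor_def x_def y_def)
    show ?thesis
      unfolding young_symmetrizer_2 Let_def t F_def by (simp add: algebra_simps)
  qed
  have alt: "alt_pairs (\<lambda>A B C D. r * F A B * F C D) A B C D = r * F A B * F C D" for r A B C D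
  proof -
    have "F B A = - F A B" "F D C = - F C D" by (simp_all add: F_def)
    then show ?thesis by (simp add: alt_pairs_def)
  qed
  have main: "phi_map ?w (([A, B], [C, D]), e)
      = 6 * young_symmetrizer 2 (unit_tensor ([c, d], [c, d])) ([A, B], [C, D]) * u e" for A B C D e
    by (simp only: phi_map_def prod.case list.case Let_def contract alt alt_four_simple_square[OF F_def] Y)
      (simp add: algebra_simps)
  have len2: "(\<exists>A B. xs = [A, B]) \<longleftrightarrow> length xs = 2" for xs :: "'n list"
    by (auto simp: length_Suc_conv numeral_2_eq_2)
  have "phi_map ?w ((as, bs), e) = 6 * young_symmetrizer 2 (unit_tensor ([c, d], [c, d])) (as, bs) * u e" for as bs e
  proof (cases "length as = 2 \<and> length bs = 2")
    case True
    then obtain A B C D where "as = [A, B]" "bs = [C, D]" using len2 by metis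
    then show ?thesis using main by simp
  next
    \<comment> \<open>Both sides have the default value 0 unless both lists have length 2.\<close>
    case False
    then have "phi_map ?w ((as, bs), e) = 0"
      by (auto simp: phi_map_def split: list.splits)
    moreover have "young_symmetrizer 2 (unit_tensor ([c, d], [c, d])) (as, bs) = 0"
      using False young_symmetrizer_eq_0 by metis
    ultimately show ?thesis by simp
  qed
  then show ?thesis by auto
qed

lemma quartic_in_J4_vecs:
  assumes "linear l" "\<And>a. (\<lambda>c. a * u c) \<in> vecs V"
  shows "(\<lambda>j. 24 * jet_lin l (jet_lin l (jet_lin l (jet_lin l u))) j) \<in> J4_vecs V"
  unfolding J4_vecs_def jet1_quartic[OF assms(1), symmetric]
proof (intro CollectI exI[of _ "\<lambda>x c. u c * l x ^ 4"] conjI allI refl)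
  show "(\<lambda>c. u c * l x ^ 4) \<in> vecs V" for x
    using assms(2)[of "l x ^ 4"] by (simp add: mult.commute)
  show "smooth_fun (\<lambda>x. u c * l x ^ 4)" for c
    by (rule smooth_fun_power[OF assms(1)])
qed

section \<open>The spanning tensors of \<open>V_mod 2\<close>\<close>

abbreviation b2 :: "'n \<Rightarrow> 'n \<Rightarrow> 'n \<Rightarrow> 'n \<Rightarrow> 'n list \<times> 'n list \<Rightarrow> real" where
  "b2 a b c d \<equiv> young_symmetrizer 2 (unit_tensor ([a, b], [c, d]))"

text \<open>Rows are symmetrized before the columns are alternated, so exchanging the two entries of
  a row has no effect.\<close>

lemma b2_swap:
  "b2 a b c d = b2 c b a d"
  "b2 a b c d = b2 a d c b"
proof -
  have eqI: "young_symmetrizer 2 t = young_symmetrizer 2 t'"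
    if "\<And>A B C D. young_symmetrizer 2 t ([A, B], [C, D]) = young_symmetrizer 2 t' ([A, B], [C, D])"
    for t t' :: "'a list \<times> 'a list \<Rightarrow> real"
  proof (rule ext, clarify)
    fix as bs :: "'a list"
    have len2: "(\<exists>A B. xs = [A, B]) \<longleftrightarrow> length xs = 2" for xs :: "'a list"
      by (auto simp: length_Suc_conv numeral_2_eq_2)
    show "young_symmetrizer 2 t (as, bs) = young_symmetrizer 2 t' (as, bs)"
      using that young_symmetrizer_eq_0 len2 by metis
  qed
  have t: "unit_tensor ([a, b], [c, d]) ([A, B], [C, D])
      = of_bool (A = a) * of_bool (B = b) * of_bool (C = c) * of_bool (D = d)" for a b c d A B C D :: 'a
    by (simp add: unit_tensor_def)
  show "b2 a b c d = b2 c b a d"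
    "b2 a b c d = b2 a d c b"
    by (rule eqI; simp only: young_symmetrizer_2 Let_def t; simp only: algebra_simps)+
qed

lemma replace_index_b2:
  "replace_index 2 C x (b2 a b c d) =
     (\<lambda>z. of_bool (a = C) * b2 x b c d z
        + of_bool (b = C) * b2 a x c d z
        + of_bool (c = C) * b2 a b x d z
        + of_bool (d = C) * b2 a b c x z)"
proof -
  let ?c = "\<lambda>i. [of_bool (a = C), of_bool (b = C), of_bool (c = C), of_bool (d = C) :: real] ! i"
  let ?t = "\<lambda>i. [unit_tensor ([x, b], [c, d]), unit_tensor ([a, x], [c, d]),
      unit_tensor ([a, b], [x, d]), unit_tensor ([a, b], [c, x])] ! i"
  \<comment> \<open>On basis tensors, reading a component with \<open>C\<close> written over
    \<open>x\<close> amounts to writing \<open>x\<close> over \<open>C\<close> in the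
    tensor.\<close>
  have up: "as ! i = x \<and> as[i := C] = L \<longleftrightarrow> as = L[i := x] \<and> L ! i = C" if "i < length L" for as L i
    using that by (metis length_list_update list_update_id list_update_overwrite nth_list_update_eq)
  have "replace_index 2 C x (unit_tensor (L, L')) (as, bs) =
      (\<Sum>i<2. of_bool (L ! i = C) * unit_tensor (L[i := x], L') (as, bs))
      + (\<Sum>i<2. of_bool (L' ! i = C) * unit_tensor (L, L'[i := x]) (as, bs))"
    if "length L = 2" "length L' = 2" for L L' as bs
  proof -
    have "(if as ! i = x then unit_tensor (L, L') (as[i := C], bs) else 0)
        = of_bool (as ! i = x \<and> as[i := C] = L) * (of_bool (bs = L') :: real)"
      "(if bs ! i = x then unit_tensor (L, L') (as, bs[i := C]) else 0)
        = of_bool (bs ! i = x \<and> bs[i := C] = L') * (of_bool (as = L) :: real)" for i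
      by (auto simp: unit_tensor_def)
    then show ?thesis
      unfolding replace_index_def split_conv using that
      by (intro arg_cong2[where f = "(+)"] sum.cong refl) (simp_all add: up, auto simp: unit_tensor_def)
  qed
  from this[of "[a, b]" "[c, d]"]
  have "replace_index 2 C x (unit_tensor ([a, b], [c, d])) = (\<lambda>z. \<Sum>i<4. ?c i * ?t i z)"
    by (auto simp: eval_nat_numeral)
  then show ?thesis
    unfolding young_symmetrizer_replace_index
    by (simp only: young_symmetrizer_linear) (simp add: eval_nat_numeral)
qed

subsection \<open>The projection onto the Cartan component\<close>

lemma act_tensor_simple:
  assumes "fin_module V" "fin_module W"
  shows "act (tensor_module V W) M (\<lambda>(c, d). q c * u d)
    = (\<lambda>(c, d). act V M q c * u d + q c * act W M u d)"
proof -
  have "act V M (\<lambda>c. q c * r) c = act V M q c * r" for c r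
    using assms(1) fin_bilinear_scale_right[of "\<lambda>M u. act V M u c"] by (simp add: fin_module_def)
  moreover have "act W M (\<lambda>d. r * u d) d = r * act W M u d" for d r
    using assms(2) fin_bilinear_scale_right[of "\<lambda>M u. act W M u d" M u r]
    by (simp add: fin_module_def mult.commute)
  ultimately show ?thesis by (simp add: tensor_module_def)
qed

lemma simple_tensor: "q \<in> vecs V \<Longrightarrow> u \<in> vecs W \<Longrightarrow> (\<lambda>(c, d). q c * u d) \<in> vecs (tensor_module V W)"
  unfolding tensor_module_def by (auto intro!: exI[of _ 1] exI[of _ "\<lambda>_. q"] exI[of _ "\<lambda>_. u"])

lemma young_symmetrizer_in_V_mod: "young_symmetrizer k t \<in> vecs (V_mod k)"
  by (simp add: V_mod_def)

lemma V_mod_sum: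
  "(\<And>i. i \<in> I \<Longrightarrow> q i \<in> vecs (V_mod j)) \<Longrightarrow> (\<lambda>z. \<Sum>i\<in>I. c i * q i z) \<in> vecs (V_mod j)"
proof (induction I rule: infinite_finite_induct)
  case (insert i I)
  then have "(\<lambda>z. c i * q i z + 1 * (\<Sum>i\<in>I. c i * q i z)) \<in> vecs (V_mod j)"
    by (intro V_mod_lincomb) auto
  then show ?case using insert.hyps by simp
qed (simp_all add: V_mod_zero)

locale column_projection =
  fixes m k :: nat and T :: "'n::finite list"
    and \<pi> :: "(('n list \<times> 'n list) \<times> ('n list \<times> 'n list) \<Rightarrow> real) \<Rightarrow> 'n list \<times> 'n list \<Rightarrow> real"
  assumes hom: "gmodule_hom g0_alg (tensor_module (V_mod 2) (V_mod m)) (V_mod k) \<pi>"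
    and T: "distinct T" "length T = k" and k: "k = m + 2"
begin

definition pairing :: "('n list \<times> 'n list \<Rightarrow> real) \<Rightarrow> ('n list \<times> 'n list \<Rightarrow> real) \<Rightarrow> real" where
  "pairing q u = \<pi> (\<lambda>(z, y). q z * u y) (T, T)"

lemma \<pi>_lincomb:
  assumes "s \<in> vecs (tensor_module (V_mod 2) (V_mod m))" "t \<in> vecs (tensor_module (V_mod 2) (V_mod m))"
  shows "\<pi> (\<lambda>c. a * s c + b * t c) = (\<lambda>d. a * \<pi> s d + b * \<pi> t d)"
  using hom assms by (simp add: gmodule_hom_def)

lemma pairing_left:
  assumes "q \<in> vecs (V_mod 2)" "q' \<in> vecs (V_mod 2)" "u \<in> vecs (V_mod m)"
  shows "pairing (\<lambda>z. a * q z + b * q' z) u = a * pairing q u + b * pairing q' u"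
  using fun_cong[OF \<pi>_lincomb[OF simple_tensor[OF assms(1,3)] simple_tensor[OF assms(2,3)], of a b], of "(T, T)"]
  by (simp add: pairing_def case_prod_unfold algebra_simps)

lemma pairing_right:
  assumes "q \<in> vecs (V_mod 2)" "u \<in> vecs (V_mod m)" "u' \<in> vecs (V_mod m)"
  shows "pairing q (\<lambda>z. a * u z + b * u' z) = a * pairing q u + b * pairing q u'"
  using fun_cong[OF \<pi>_lincomb[OF simple_tensor[OF assms(1,2)] simple_tensor[OF assms(1,3)], of a b], of "(T, T)"]
  by (simp add: pairing_def case_prod_unfold algebra_simps)

lemma pairing_sum_left:
  assumes "u \<in> vecs (V_mod m)"
  shows "(\<And>i. i \<in> I \<Longrightarrow> q i \<in> vecs (V_mod 2)) \<Longrightarrow>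
    pairing (\<lambda>z. \<Sum>i\<in>I. c i * q i z) u = (\<Sum>i\<in>I. c i * pairing (q i) u)"
proof (induction I rule: infinite_finite_induct)
  case (insert i I)
  then have "pairing (\<lambda>z. c i * q i z + 1 * (\<Sum>i\<in>I. c i * q i z)) u
      = c i * pairing (q i) u + 1 * pairing (\<lambda>z. \<Sum>i\<in>I. c i * q i z) u"
    by (intro pairing_left V_mod_sum assms) auto
  then show ?case using insert by simp
qed (use pairing_left[OF V_mod_zero(1) V_mod_zero(1) assms, of 0 0] in simp_all)

lemma pairing_sum_right:
  assumes "q \<in> vecs (V_mod 2)"
  shows "(\<And>i. i \<in> I \<Longrightarrow> u i \<in> vecs (V_mod m)) \<Longrightarrow>
    pairing q (\<lambda>z. \<Sum>i\<in>I. c i * u i z) = (\<Sum>i\<in>I. c i * pairing q (u i))"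
proof (induction I rule: infinite_finite_induct)
  case (insert i I)
  then have "pairing q (\<lambda>z. c i * u i z + 1 * (\<Sum>i\<in>I. c i * u i z))
      = c i * pairing q (u i) + 1 * pairing q (\<lambda>z. \<Sum>i\<in>I. c i * u i z)"
    by (intro pairing_right V_mod_sum assms) auto
  then show ?case using insert by simp
qed (use pairing_right[OF assms V_mod_zero(1) V_mod_zero(1), of 0 0] in simp_all)

lemma pairing_act:
  assumes "M \<in> g0_alg" "q \<in> vecs (V_mod 2)" "u \<in> vecs (V_mod m)"
    and "act (V_mod 2) M q \<in> vecs (V_mod 2)" "act (V_mod m) M u \<in> vecs (V_mod m)"
  shows "pairing (act (V_mod 2) M q) u + pairing q (act (V_mod m) M u)
    = act (V_mod k) M (\<pi> (\<lambda>(z, y). q z * u y)) (T, T)"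
proof -
  have "\<pi> (act (tensor_module (V_mod 2) (V_mod m)) M (\<lambda>(z, y). q z * u y))
      = act (V_mod k) M (\<pi> (\<lambda>(z, y). q z * u y))"
    using hom assms(1) simple_tensor[OF assms(2,3)] by (simp add: gmodule_hom_def)
  then show ?thesis
    using \<pi>_lincomb[OF simple_tensor[OF assms(4,3)] simple_tensor[OF assms(2,5)], of 1 1]
    by (simp add: pairing_def case_prod_unfold act_tensor_simple[OF fin_module_V_mod fin_module_V_mod, unfolded case_prod_unfold]
        fun_eq_iff)
qed

lemma \<pi>_simple_in_V_mod:
  "q \<in> vecs (V_mod 2) \<Longrightarrow> u \<in> vecs (V_mod m) \<Longrightarrow> \<pi> (\<lambda>(z, y). q z * u y) \<in> vecs (V_mod k)"
  using hom simple_tensor[of q "V_mod 2" u "V_mod m"] by (simp add: gmodule_hom_def)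

text \<open>For distinct indices the matrix unit has trace zero, and the right-hand side of
  \<open>pairing_act\<close> vanishes because \<open>C\<close> already occurs in
  \<open>T\<close>.\<close>

lemma pairing_replace_index:
  assumes "q \<in> vecs (V_mod 2)" "u \<in> vecs (V_mod m)" "C \<in> set T" "x \<noteq> C"
  shows "pairing (replace_index 2 C x q) u + pairing q (replace_index m C x u) = 0"
proof -
  have "N_unit C x \<in> (g0_alg :: 'n gmat set)"
    using assms(4) by (intro g0_algI matrix_unit_in_p_alg) (auto simp: matrix_unit_apply)
  from pairing_act[OF this assms(1,2)] show ?thesis
    using assms T
    by (simp add: V_mod_act_N_unit V_mod_replace_index replace_index_top_off_diagonal \<pi>_simple_in_V_mod)
qed

text \<open>The \<open>gl(2)\<close> part of the matrix only restores total trace zero; it cancels because \<open>k = m + 2\<close>.\<close>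

lemma pairing_replace_index_diagonal:
  assumes "q \<in> vecs (V_mod 2)" "u \<in> vecs (V_mod m)"
  shows "pairing (replace_index 2 C C q) u + pairing q (replace_index m C C u)
    = 2 * of_bool (C \<in> set T) * pairing q u"
proof -
  let ?M = "N_unit C C + N_unit C C + P_unit 0 0 + P_unit 1 1 :: 'n gmat"
  have M: "?M \<in> g0_alg"
  proof (rule g0_algI)
    have "trace ?M = 0"
    proof -
      have "(\<Sum>i\<in>UNIV. of_bool (i = j)) = (1 :: real)" for j :: "2 + 'n" by (simp add: of_bool_def)
      then show ?thesis by (simp add: trace_def matrix_unit_apply sum.distrib sum_negf
          sum_subtractf sum_distrib_left[symmetric])
    qed
    then show "?M \<in> p_alg" by (auto simp: p_alg_def matrix_unit_apply)
  qed (auto simp: matrix_unit_apply)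
  have a: "act (V_mod j) ?M v = (\<lambda>z. 2 * replace_index j C C v z + 2 * real j * v z)" for j and v :: "'n list \<times> 'n list \<Rightarrow> real"
    unfolding act_linear(4)[OF fin_module_V_mod] V_mod_act_N_unit V_mod_act_P_unit
    by (simp add: fun_eq_iff)
  have rk: "real k = real m + 2" by (simp add: k)
  note R = V_mod_replace_index[OF assms(1), of C C] V_mod_replace_index[OF assms(2), of C C]
  show ?thesis
    using pairing_act[OF M assms] unfolding a
    by (simp add: V_mod_lincomb R assms pairing_left pairing_right replace_index_top_diagonal[OF T]
        rk pairing_def[symmetric]) (cases "C \<in> set T"; simp add: algebra_simps)
qed

lemma T_split: "T = T ! 0 # T ! 1 # drop 2 T" and T_01: "T ! 0 \<noteq> T ! 1" "T ! 0 \<in> set T" "T ! 1 \<in> set T"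
proof -
  show "T = T ! 0 # T ! 1 # drop 2 T"
    using T k by (cases T; cases "tl T") auto
  show "T ! 0 \<noteq> T ! 1" "T ! 0 \<in> set T" "T ! 1 \<in> set T"
    using T k by (auto simp: nth_eq_iff_index_eq)
qed

abbreviation "q0 \<equiv> b2 (T ! 0) (T ! 1) (T ! 0) (T ! 1)"

text \<open>For such \<open>C\<close> the weight of \<open>q0\<close> already equals the weight of
  the \<open>(T, T)\<close> component: 2 for the first two indices of \<open>T\<close> and 0 for
  indices outside \<open>T\<close>. Nothing is left for \<open>u\<close>.\<close>

lemma pairing_q0_diagonal:
  assumes "C \<notin> set (drop 2 T)" "u \<in> vecs (V_mod m)"
  shows "pairing q0 (replace_index m C C u) = 0"
proof -
  let ?n = "real (count (mset [T ! 0, T ! 1] + mset [T ! 0, T ! 1]) C)"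
  have "set T = {T ! 0, T ! 1} \<union> set (drop 2 T)" by (subst T_split) simp
  then have n: "?n = 2 * of_bool (C \<in> set T)" using assms(1) T_01(1) by auto
  have "pairing (replace_index 2 C C q0) u = ?n * pairing q0 u"
    unfolding replace_index_diagonal
    using pairing_left[OF young_symmetrizer_in_V_mod V_mod_zero(1) assms(2), of ?n _ 0] by simp
  then show ?thesis
    using pairing_replace_index_diagonal[OF young_symmetrizer_in_V_mod assms(2), of C "unit_tensor ([T ! 0, T ! 1], [T ! 0, T ! 1])"]
    unfolding n by simp
qed

text \<open>A replacement can be moved from the left factor to \<open>u\<close>, where it stays
  inside \<open>V_mod m\<close>. So a tensor that pairs to zero with all of \<open>V_mod m\<close>
  passes this property on to its image under the replacement.\<close>

lemma pairing_b2_step: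
  assumes "C \<in> set T" "x \<noteq> C" "\<And>u. u \<in> vecs (V_mod m) \<Longrightarrow> pairing (b2 a b c d) u = 0"
    and u: "u \<in> vecs (V_mod m)"
  shows "of_bool (a = C) * pairing (b2 x b c d) u + of_bool (b = C) * pairing (b2 a x c d) u
    + of_bool (c = C) * pairing (b2 a b x d) u + of_bool (d = C) * pairing (b2 a b c x) u = 0"
proof -
  let ?c = "\<lambda>i. [of_bool (a = C), of_bool (b = C), of_bool (c = C), of_bool (d = C) :: real] ! i"
  let ?q = "\<lambda>i. young_symmetrizer 2 ([unit_tensor ([x, b], [c, d]), unit_tensor ([a, x], [c, d]),
      unit_tensor ([a, b], [x, d]), unit_tensor ([a, b], [c, x])] ! i)"
  have "replace_index 2 C x (b2 a b c d) = (\<lambda>z. \<Sum>i<4. ?c i * ?q i z)"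
    unfolding replace_index_b2 by (simp add: eval_nat_numeral)
  then have "pairing (replace_index 2 C x (b2 a b c d)) u = (\<Sum>i<4. ?c i * pairing (?q i) u)"
    by (simp only: pairing_sum_left[OF u young_symmetrizer_in_V_mod])
  moreover have "pairing (replace_index 2 C x (b2 a b c d)) u = 0"
    using pairing_replace_index[OF young_symmetrizer_in_V_mod[of 2 "unit_tensor ([a, b], [c, d])"] u assms(1,2)]
      assms(3)[OF V_mod_replace_index[OF u, of C x]]
    by simp
  ultimately show ?thesis by (simp add: eval_nat_numeral)
qed

text \<open>
  Starting from \<open>(e\<^sub>c \<and> e\<^sub>d)\<^sup>2\<close>, replace the two copies of \<open>e\<^sub>c\<close> and then those of \<open>e\<^sub>d\<close> one at a time; the other
  terms produced by each replacement are covered by the preceding steps.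
\<close>

lemma pairing_b2_eq_0:
  assumes base: "\<And>u. u \<in> vecs (V_mod m) \<Longrightarrow> pairing q0 u = 0" and "u \<in> vecs (V_mod m)"
  shows "pairing (b2 a b c d) u = 0"
proof -
  let ?e = "T ! 0" and ?f = "T ! 1"
  define P where "P a b c d \<longleftrightarrow> (\<forall>u\<in>vecs (V_mod m). pairing (b2 a b c d) u = 0)" for a b c d
  note step = pairing_b2_step[OF T_01(2), folded P_def] pairing_b2_step[OF T_01(3), folded P_def]
  have 1: "P a ?f ?e ?f" for a
  proof (cases "a = ?e")
    case False
    \<comment> \<open>Both copies of \<open>?e\<close> are hit, and by row symmetry the two results
      coincide, so twice the pairing is zero.\<close>
    have "pairing (b2 a ?f ?e ?f) u = 0" if "u \<in> vecs (V_mod m)" for u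
      using step(1)[OF False base that] T_01(1) b2_swap(1)[of ?e ?f a ?f] by simp
    then show ?thesis by (simp add: P_def)
  next
    case True
    then show ?thesis unfolding P_def using base by blast
  qed
  have 2: "P a ?f c ?f" for a c
  proof (cases "c = ?e")
    case False
    have "pairing (b2 a ?f c ?f) u = 0" if "u \<in> vecs (V_mod m)" for u
      using step(1)[OF False _ that, of a ?f ?e ?f] 1[unfolded P_def] that T_01(1) by simp
    then show ?thesis by (simp add: P_def)
  qed (simp add: 1 del: One_nat_def)
  have 3: "P a b c ?f" for a b c
  proof (cases "b = ?f")
    case False
    \<comment> \<open>The two copies of \<open>?f\<close> in the second row again give equal terms;
      if \<open>a\<close> or \<open>c\<close> is \<open>?f\<close>, the additional terms are
      instances of \<open>2\<close>.\<close>
    have "pairing (b2 a b c ?f) u = 0" if "u \<in> vecs (V_mod m)" for u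
      using step(2)[OF False _ that, of a ?f c ?f] 2[unfolded P_def] that b2_swap(2)[of a ?f c b] by simp
    then show ?thesis by (simp add: P_def)
  qed (simp add: 2 del: One_nat_def)
  have "P a b c d"
  proof (cases "d = ?f")
    case False
    have "pairing (b2 a b c d) u = 0" if "u \<in> vecs (V_mod m)" for u
      using step(2)[OF False _ that, of a b c ?f] 3[unfolded P_def] that by simp
    then show ?thesis by (simp add: P_def)
  qed (simp add: 3 del: One_nat_def)
  then show ?thesis using assms(2) by (simp add: P_def)
qed

lemma projection_top_eq_0:
  assumes base: "\<And>u. u \<in> vecs (V_mod m) \<Longrightarrow> pairing q0 u = 0"
    and t: "t \<in> vecs (tensor_module (V_mod 2) (V_mod m))"
  shows "\<pi> t (T, T) = 0"
proof -
  have pair0: "pairing q u = 0" if "q \<in> vecs (V_mod 2)" "u \<in> vecs (V_mod m)" for q u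
  proof -
    obtain t where q: "q = young_symmetrizer 2 t" using \<open>q \<in> _\<close> by (auto simp: V_mod_def)
    have "pairing (young_symmetrizer 2 (unit_tensor w)) u = 0" if "w \<in> list_pairs 2" for w
    proof -
      obtain a b c d where "w = ([a, b], [c, d])"
        using \<open>w \<in> _\<close> by (auto simp: list_pairs_def length_Suc_conv numeral_2_eq_2)
      then show ?thesis using pairing_b2_eq_0[OF base \<open>u \<in> _\<close>] by simp
    qed
    then show ?thesis
      unfolding q by (subst young_symmetrizer_expand) (simp add: pairing_sum_left[OF \<open>u \<in> _\<close> young_symmetrizer_in_V_mod])
  qed
  obtain n :: nat and q u where t: "t = (\<lambda>(c, d). \<Sum>i<n. q i c * u i d)"
    and qu: "\<And>i. i < n \<Longrightarrow> q i \<in> vecs (V_mod 2)" "\<And>i. i < n \<Longrightarrow> u i \<in> vecs (V_mod m)"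
    using t by (auto simp: tensor_module_def)
  \<comment> \<open>Linearity of \<open>\<pi>\<close> is available only on the tensor module, so
    each partial sum has to be shown to lie in it.\<close>
  have "j \<le> n \<Longrightarrow> \<pi> (\<lambda>(c, d). \<Sum>i<j. q i c * u i d) (T, T) = 0" for j
  proof (induction j)
    case 0
    have "(\<lambda>c. 0) \<in> vecs (tensor_module (V_mod 2) (V_mod m))"
      using simple_tensor[OF V_mod_zero(1) V_mod_zero(1), of 2 m] by (simp add: case_prod_unfold)
    from \<pi>_lincomb[OF this this, of 0 0] show ?case by (simp add: case_prod_unfold)
  next
    case (Suc j)
    have "(\<lambda>(c, d). \<Sum>i<j. q i c * u i d) \<in> vecs (tensor_module (V_mod 2) (V_mod m))"
      unfolding tensor_module_def gmodule.select_convs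
    proof (intro CollectI exI conjI)
      show "\<forall>i<j. q i \<in> vecs (V_mod 2) \<and> u i \<in> vecs (V_mod m)" using qu Suc.prems by auto
    qed simp
    moreover have "(\<lambda>(c, d). q j c * u j d) \<in> vecs (tensor_module (V_mod 2) (V_mod m))"
      using Suc.prems by (intro simple_tensor qu) auto
    ultimately have "\<pi> (\<lambda>x. 1 * (\<lambda>(c, d). \<Sum>i<j. q i c * u i d) x + 1 * (\<lambda>(c, d). q j c * u j d) x) (T, T)
        = 0 + pairing (q j) (u j)"
      using Suc by (simp only: \<pi>_lincomb) (simp add: pairing_def)
    then show ?case using pair0[of "q j" "u j"] qu Suc.prems by (simp add: case_prod_unfold)
  qed
  from this[of n] show ?thesis by (simp add: t)
qed

text \<open>A tensor containing an index outside \<open>drop 2 T\<close> has the wrong weight and pairs to zero.\<close>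

lemma pairing_q0_eq_0:
  assumes H: "\<And>u. u \<in> vecs (V_mod m) \<Longrightarrow>
      (\<And>C a. C \<notin> set (drop 2 T) \<Longrightarrow> replace_index m C a u = 0) \<Longrightarrow> pairing q0 u = 0"
    and "u \<in> vecs (V_mod m)"
  shows "pairing q0 u = 0"
proof -
  obtain t where u: "u = young_symmetrizer m t" using assms(2) by (auto simp: V_mod_def)
  have "pairing q0 (young_symmetrizer m (unit_tensor w)) = 0" for w
  proof -
    obtain cs ds where w: "w = (cs, ds)" by force
    let ?y = "young_symmetrizer m (unit_tensor w)"
    show ?thesis
    proof (cases "set cs \<union> set ds \<subseteq> set (drop 2 T)")
      case True
      then show ?thesis
        unfolding w by (intro H young_symmetrizer_in_V_mod replace_index_unit_absent) auto
    next
      case False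
      then obtain C where C: "C \<in> set cs \<union> set ds" "C \<notin> set (drop 2 T)" by auto
      let ?n = "real (count (mset cs + mset ds) C)"
      have "?n * pairing q0 ?y = pairing q0 (replace_index m C C ?y)"
        unfolding w replace_index_diagonal
        using pairing_right[OF young_symmetrizer_in_V_mod young_symmetrizer_in_V_mod V_mod_zero(1), of _ ?n _ 0] by simp
      also have "\<dots> = 0" by (rule pairing_q0_diagonal[OF C(2) young_symmetrizer_in_V_mod])
      finally have "?n * pairing q0 ?y = 0" .
      moreover have "0 < count (mset cs + mset ds) C"
        using C(1) by (subst count_greater_zero_iff) auto
      ultimately show ?thesis by (metis mult_eq_0_iff of_nat_eq_0_iff less_numeral_extra(3))
    qed
  qed
  then show ?thesis
    unfolding u by (subst young_symmetrizer_expand) (simp add: pairing_sum_right[OF young_symmetrizer_in_V_mod young_symmetrizer_in_V_mod])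
qed

end

section \<open>The contradiction with surjectivity\<close>

text \<open>Since \<open>T\<close> has distinct entries, only the identity permutations reproduce
  \<open>(T, T)\<close>. The two entries of each row are then equal, so all \<open>2 ^ k\<close> row
  swaps contribute 1 and nothing cancels.\<close>

lemma young_symmetrizer_top:
  assumes "distinct T" "length T = k"
  shows "young_symmetrizer k (unit_tensor (T, T)) (T, T) \<noteq> 0"
proof -
  have rs: "row_swap k S (permute_list p T, permute_list q T) = (T, T) \<longleftrightarrow> p = id \<and> q = id"
    if pq: "p permutes {..<k}" "q permutes {..<k}" for p q S
  proof
    assume *: "row_swap k S (permute_list p T, permute_list q T) = (T, T)"
    have "T ! p i = T ! i \<and> T ! q i = T ! i" if "i < k" for i
    proof -
      have "fst (row_swap k S (permute_list p T, permute_list q T)) ! i = T ! i"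
        "snd (row_swap k S (permute_list p T, permute_list q T)) ! i = T ! i"
        by (simp_all only: * fst_conv snd_conv)
      then show ?thesis
        using that assms(2) pq by (cases "i \<in> S") (simp_all add: row_swap_def permute_list_nth)
    qed
    then have "p i = i \<and> q i = i" if "i < k" for i
      using that assms permutes_in_image[OF pq(1), of i] permutes_in_image[OF pq(2), of i]
        nth_eq_iff_index_eq[OF assms(1), of _ i] by auto
    moreover have "p i = i \<and> q i = i" if "\<not> i < k" for i
      using that permutes_not_in[OF pq(1), of i] permutes_not_in[OF pq(2), of i] by simp
    ultimately show "p = id \<and> q = id" by (metis eq_id_iff)
  next
    assume "p = id \<and> q = id"
    then show "row_swap k S (permute_list p T, permute_list q T) = (T, T)"
      using assms(2)[symmetric] by (simp add: row_swap_def map_nth)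
  qed
  let ?P = "{p. p permutes {..<k}}"
  have P: "finite ?P" "id \<in> ?P" by (simp_all add: finite_permutations permutes_id)
  have "of_int (sign p * sign q) * (\<Sum>S\<in>Pow {..<k}. unit_tensor (T, T) (row_swap k S (permute_list p T, permute_list q T)))
      = (if p = id then if q = id then 2 ^ k else 0 else (0 :: real))" if "p \<in> ?P" "q \<in> ?P" for p q
    using that by (simp add: unit_tensor_def rs card_Pow)
  then have "young_symmetrizer k (unit_tensor (T, T)) (T, T)
      = (\<Sum>p\<in>?P. \<Sum>q\<in>?P. if p = id then if q = id then 2 ^ k else 0 else 0)"
    unfolding young_symmetrizer_def using assms(2) by simp
  also have "\<dots> = (\<Sum>p\<in>?P. if p = id then \<Sum>q\<in>?P. if q = id then 2 ^ k else 0 else 0)"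
    by (rule sum.cong) simp_all
  also have "\<dots> = 2 ^ k" using P by (simp only: sum.delta if_True)
  finally show ?thesis by simp
qed

theorem proposition3p1:
  fixes k :: nat
    and \<pi> :: "(('n::finite list \<times> 'n list) \<times> ('n list \<times> 'n list) \<Rightarrow> real) \<Rightarrow> 'n list \<times> 'n list \<Rightarrow> real"
  assumes "CARD('n) \<ge> 2" and "2 \<le> k" and "k \<le> CARD('n)"
    and "gmodule_hom g0_alg (tensor_module (V_mod 2) (V_mod (k - 2))) (V_mod k) \<pi>"
    and "\<pi> ` vecs (tensor_module (V_mod 2) (V_mod (k - 2))) = vecs (V_mod k)"
  shows "\<not> (\<exists>\<Psi>. gmodule_hom p_alg (Jbar4_mod (V_mod (k - 2))) (V_mod k) \<Psi> \<and>
                (\<forall>j \<in> J4_vecs (V_mod (k - 2)). \<Psi> j = Phi_hom \<pi> j))"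
proof
  assume "\<exists>\<Psi>. gmodule_hom p_alg (Jbar4_mod (V_mod (k - 2))) (V_mod k) \<Psi> \<and>
                (\<forall>j \<in> J4_vecs (V_mod (k - 2)). \<Psi> j = Phi_hom \<pi> j)"
  then obtain \<Psi> where \<Psi>: "gmodule_hom p_alg (Jbar4_mod (V_mod (k - 2))) (V_mod k) \<Psi>"
    and ext: "\<And>j. j \<in> J4_vecs (V_mod (k - 2)) \<Longrightarrow> \<Psi> j = Phi_hom \<pi> j" by blast
  \<comment> \<open>The bound on \<open>k\<close> provides \<open>k\<close> distinct
    indices.\<close>
  obtain S :: "'n set" where "card S = k" "finite S"
    using obtain_subset_with_card_n[OF assms(3)] by (metis finite)
  then obtain T :: "'n list" where T: "distinct T" "length T = k"
    using finite_distinct_list distinct_card by metis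
  have k: "k = (k - 2) + 2" using assms(2) by simp
  interpret E: strong_extension "k - 2" k T \<Psi>
    using \<Psi> T k by unfold_locales
  interpret C: column_projection "k - 2" k T \<pi>
    using assms(4) T k by unfold_locales
  have main: "C.pairing C.q0 u = 0"
    if u: "u \<in> vecs (V_mod (k - 2))"
      and absent: "\<And>C a. C \<notin> set (drop 2 T) \<Longrightarrow> replace_index (k - 2) C a u = 0" for u
  proof -
    let ?e = "(0, T ! 0) :: 'n slot" and ?e' = "(1, T ! 1) :: 'n slot"
    \<comment> \<open>The form pairs the two primed indices with the first two entries of
      \<open>T\<close>, so \<open>J\<close> is \<open>u\<close> times its fourth tensor power,
      expanded below into sixteen monomials.\<close>
    define l where "l = (\<lambda>x :: 'n gminus. slot_coord ?e x + slot_coord ?e' x)"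
    define J where "J = jet_lin l (jet_lin l (jet_lin l (jet_lin l u)))"
    have l: "linear l" unfolding l_def by (intro linear_compose_add linear_slot_coord)
    have au: "(\<lambda>c. a * u c) \<in> vecs (V_mod (k - 2))" for a
      using V_mod_lincomb[OF u u, of a 0] by simp
    have J: "J = (\<Sum>s1\<in>{?e, ?e'}. \<Sum>s2\<in>{?e, ?e'}. \<Sum>s3\<in>{?e, ?e'}. \<Sum>s4\<in>{?e, ?e'}. monomial_jet s1 s2 s3 s4 u)"
      unfolding J_def l_def jet_lin_two_slots monomial_jet_def by (simp add: add_ac)
    have "J \<in> vecs E.J4"
      unfolding J by (intro E.sum_J4 vecs_Jbar4(1) u)
    moreover have "(\<Sum>s1\<in>{?e, ?e'}. \<Sum>s2\<in>{?e, ?e'}. \<Sum>s3\<in>{?e, ?e'}. \<Sum>s4\<in>{?e, ?e'}.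
        E.top (monomial_jet s1 s2 s3 s4 u)) = 0"
      by (rule E.top_determinant_square[OF u]) (rule absent)
    then have "E.top J = 0"
      unfolding J by (simp only: E.top_sum E.sum_J4 vecs_Jbar4(1)[OF u])
    ultimately have "E.top (\<lambda>j. 24 * J j) = 0" by (simp add: E.top_scale)
    \<comment> \<open>By \<open>jet1_quartic\<close> this is the 4-jet of the section
      \<open>u c * l x ^ 4\<close>, hence holonomic, and the extension property applies.\<close>
    moreover have "\<Psi> (\<lambda>j. 24 * J j) = Phi_hom \<pi> (\<lambda>j. 24 * J j)"
      unfolding J_def by (intro ext quartic_in_J4_vecs l au)
    moreover have "Phi_hom \<pi> (\<lambda>j. 24 * J j) (T, T) = C.pairing (\<lambda>z. 6 * C.q0 z) u"
      unfolding Phi_hom_def J_def l_def phi_map_quartic by (simp add: C.pairing_def)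
    moreover have "C.pairing (\<lambda>z. 6 * C.q0 z) u = 6 * C.pairing C.q0 u"
      using C.pairing_left[OF young_symmetrizer_in_V_mod V_mod_zero(1) u, of 6 _ 0] by simp
    ultimately show ?thesis by (simp add: E.top_def)
  qed
  have "C.pairing C.q0 u = 0" if "u \<in> vecs (V_mod (k - 2))" for u
    by (rule C.pairing_q0_eq_0[OF main that])
  from C.projection_top_eq_0[OF this]
  have "\<pi> t (T, T) = 0" if "t \<in> vecs (tensor_module (V_mod 2) (V_mod (k - 2)))" for t
    using that by simp
  \<comment> \<open>By surjectivity this vector lies in the image of \<open>\<pi>\<close>, although
    its \<open>(T, T)\<close> component is nonzero.\<close>
  moreover have "young_symmetrizer k (unit_tensor (T, T)) \<in> \<pi> ` vecs (tensor_module (V_mod 2) (V_mod (k - 2)))"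
    unfolding assms(5) by (rule young_symmetrizer_in_V_mod)
  ultimately show False using young_symmetrizer_top[OF T] by auto
qed

end
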